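(* Let $\varepsilon>0$, $\delta>0$ and $\zeta\in(0,1/2]$. There exists an $(\varepsilon,\delta)$-DP (event-level) continual mechanism for the vector version of incremental monotone symmetric norm estimation on $n$ elements and streams of length $T$ such that for each fixed time step $t$, with probability at least $2/3$, its output $E^t\in\mathbb R^n$ satisfies, simultaneously for all monotone symmetric norms $L$, $$(1+\zeta)^{-1}L(f^t)-\alpha\cdot L(e_1)\le L(E^t)\le(1+\zeta)L(f^t)+\alpha\cdot L(e_1),\qquad \alpha=\tilde O\Big(\frac{\log^{2.5}(T)\,\log^{0.5}(nT)\,\log(1/\delta)}{\varepsilon^2\zeta^5}\Big).$$
   Context: Incremental streams over universe $[n]\cup\{\bot\}$: each update inserts one element of $[n]$ or is the empty element $\bot$; $f^t\in\mathbb N^n$ is the frequency vector after $t$ updates. A norm $L$ on $\mathbb R^n$ is monotone if $|f_i|\le|f'_i|$ for all $i$ implies $L(f)\le L(f')$, and symmetric if invariant under permutations of coordinates; $e_1=(1,0,\dots,0)$. Vector version: at each time step the mechanism outputs a vector $E^t\in\mathbb R^n$. Two streams are event-level neighboring if they differ in at most one time step; $(\varepsilon,\delta)$-DP: $\Pr[\mathcal A(u)\in S]\le e^\varepsilon\Pr[\mathcal A(v)\in S]+\delta$ for all neighbors and output sets $S$ (output = the whole sequence $E^1,\dots,E^T$). $\tilde O$ hides lower-order polylogarithmic factors (e.g. in $\log(nT)$, $\log(1/\delta)$, $1/\varepsilon$, $1/\zeta$). *)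

theory Defs
  imports "HOL-Probability.Probability"
begin

text \<open>Streams: a stream of length T over the universe [n] (coordinates 0..n-1) is
 a function s :: nat => nat option, where s t for t in {1..T} is the t-th update
 (None = empty element), and s t = None outside {1..T}.\<close>

definition valid_stream :: "nat \<Rightarrow> nat \<Rightarrow> (nat \<Rightarrow> nat option) \<Rightarrow> bool" where
  "valid_stream n T s \<longleftrightarrow> (\<forall>t. s t \<noteq> None \<longrightarrow> t \<in> {1..T} \<and> the (s t) < n)"

definition event_neighbors :: "nat \<Rightarrow> nat \<Rightarrow> (nat \<Rightarrow> nat option) \<Rightarrow> (nat \<Rightarrow> nat option) \<Rightarrow> bool" where
  "event_neighbors n T u v \<longleftrightarrow> valid_stream n T u \<and> valid_stream n T v \<and> card {t. u t \<noteq> v t} \<le> 1"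

definition freq :: "(nat \<Rightarrow> nat option) \<Rightarrow> nat \<Rightarrow> nat \<Rightarrow> real" where
  "freq s t i = real (card {r \<in> {1..t}. s r = Some i})"

definition vecs :: "nat \<Rightarrow> (nat \<Rightarrow> real) set" where
  "vecs n = {x. \<forall>i\<ge>n. x i = 0}"

definition e1 :: "nat \<Rightarrow> real" where
  "e1 = (\<lambda>i. if i = 0 then 1 else 0)"

definition is_norm_on :: "nat \<Rightarrow> ((nat \<Rightarrow> real) \<Rightarrow> real) \<Rightarrow> bool" where
  "is_norm_on n L \<longleftrightarrow>
     (\<forall>x\<in>vecs n. L x \<ge> 0 \<and> (L x = 0 \<longleftrightarrow> x = (\<lambda>_. 0))) \<and>
     (\<forall>x\<in>vecs n. \<forall>c::real. L (\<lambda>i. c * x i) = \<bar>c\<bar> * L x) \<and>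
     (\<forall>x\<in>vecs n. \<forall>y\<in>vecs n. L (\<lambda>i. x i + y i) \<le> L x + L y)"

definition monotone_norm :: "nat \<Rightarrow> ((nat \<Rightarrow> real) \<Rightarrow> real) \<Rightarrow> bool" where
  "monotone_norm n L \<longleftrightarrow> (\<forall>x\<in>vecs n. \<forall>y\<in>vecs n. (\<forall>i<n. \<bar>x i\<bar> \<le> \<bar>y i\<bar>) \<longrightarrow> L x \<le> L y)"

definition symmetric_norm :: "nat \<Rightarrow> ((nat \<Rightarrow> real) \<Rightarrow> real) \<Rightarrow> bool" where
  "symmetric_norm n L \<longleftrightarrow> (\<forall>x\<in>vecs n. \<forall>p. p permutes {..<n} \<longrightarrow> L (x \<circ> p) = L x)"

definition mon_sym_norm :: "nat \<Rightarrow> ((nat \<Rightarrow> real) \<Rightarrow> real) \<Rightarrow> bool" where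
  "mon_sym_norm n L \<longleftrightarrow> is_norm_on n L \<and> monotone_norm n L \<and> symmetric_norm n L"

definition out_space :: "nat \<Rightarrow> nat \<Rightarrow> (nat \<times> nat \<Rightarrow> real) measure" where
  "out_space n T = PiM ({1..T} \<times> {..<n}) (\<lambda>_. borel)"

definition out_vec :: "nat \<Rightarrow> (nat \<times> nat \<Rightarrow> real) \<Rightarrow> nat \<Rightarrow> nat \<Rightarrow> real" where
  "out_vec n E t = (\<lambda>i. if i < n then E (t, i) else 0)"

text \<open>A continual mechanism: for each valid stream a probability distribution on the
 output sequence, which is online (the law of E^1..E^t depends only on the first t updates).\<close>
definition continual_mechanism :: "nat \<Rightarrow> nat \<Rightarrow> ((nat \<Rightarrow> nat option) \<Rightarrow> (nat \<times> nat \<Rightarrow> real) measure) \<Rightarrow> bool" where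
  "continual_mechanism n T M \<longleftrightarrow>
     (\<forall>s. valid_stream n T s \<longrightarrow> prob_space (M s) \<and> sets (M s) = sets (out_space n T)
                                  \<and> space (M s) = space (out_space n T)) \<and>
     (\<forall>u v t. valid_stream n T u \<longrightarrow> valid_stream n T v \<longrightarrow> (\<forall>r\<in>{1..t}. u r = v r) \<longrightarrow>
        distr (M u) (PiM ({1..min t T} \<times> {..<n}) (\<lambda>_. borel)) (\<lambda>E. restrict E ({1..min t T} \<times> {..<n}))
      = distr (M v) (PiM ({1..min t T} \<times> {..<n}) (\<lambda>_. borel)) (\<lambda>E. restrict E ({1..min t T} \<times> {..<n})))"

definition event_DP :: "real \<Rightarrow> real \<Rightarrow> nat \<Rightarrow> nat \<Rightarrow> ((nat \<Rightarrow> nat option) \<Rightarrow> (nat \<times> nat \<Rightarrow> real) measure) \<Rightarrow> bool" where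
  "event_DP \<epsilon> \<delta> n T M \<longleftrightarrow>
     (\<forall>u v. event_neighbors n T u v \<longrightarrow>
        (\<forall>S\<in>sets (out_space n T). measure (M u) S \<le> exp \<epsilon> * measure (M v) S + \<delta>))"

text \<open>Logarithm clipped below at 1 (standard convention inside O-notation).\<close>
definition lg :: "real \<Rightarrow> real" where
  "lg x = max 1 (ln x)"

end

theory Submission
  imports Defs
begin

text \<open>For a symmetric norm only the level counts \<open>#{i. f\<^sub>i \<ge> k}\<close> matter. They are replaced by the
  clipped masses \<open>S\<^sub>j = \<Sum>\<^sub>i (min f\<^sub>i a\<^sub>j\<^sub>+\<^sub>1 - min f\<^sub>i a\<^sub>j)\<close> on a grid \<open>a\<close> growing by factors \<open>1 + \<zeta>\<close>: their
  sensitivity is 1, although they are as large as \<open>w\<^sub>j = a\<^sub>j\<^sub>+\<^sub>1 - a\<^sub>j\<close> times the number of coordinates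
  above \<open>a\<^sub>j\<^sub>+\<^sub>1\<close>. Each \<open>S\<^sub>j\<close> is a running count, released by a binary tree with discrete Laplace
  noise; one update moves \<open>S\<^sub>j\<close> by differences of step functions of time, so that the
  mechanism is even purely \<open>\<epsilon>\<close>-private. Coordinate \<open>i\<close> of the output adds up the widths \<open>w\<^sub>j\<close> of the
  layers whose noisy mass is at least \<open>w\<^sub>j (i + 1/2)\<close>. Noise of size \<open>B\<^sub>j\<close> spoils at most
  \<open>4 (B\<^sub>j / w\<^sub>j)\<^sup>2\<close> coordinates of layer \<open>j\<close>, because it spoils none if \<open>B\<^sub>j < w\<^sub>j / 2\<close>; hence the additive
  error is at most \<open>\<Sum>\<^sub>j 4 B\<^sub>j\<^sup>2 / w\<^sub>j\<close>. Since \<open>w\<^sub>j\<close> grows geometrically, privacy budgets and failure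
  probabilities decaying geometrically in \<open>j\<close> make this sum \<open>O(log\<^sup>3 T / (\<epsilon>\<^sup>2 \<zeta>\<^sup>5))\<close>.\<close>

section \<open>Discrete Laplace noise\<close>

text \<open>Two-sided geometric distribution with inverse scale \<open>e\<close>. Integer noise
  suits the integer layer masses and keeps the sample space discrete, so measurability of the
  release is automatic.\<close>

definition discrete_laplace :: "real \<Rightarrow> int pmf" where
  "discrete_laplace e =
     embed_pmf (\<lambda>z. (1 - exp (-e)) / (1 + exp (-e)) * exp (-e * \<bar>real_of_int z\<bar>))"

lemma nn_integral_two_sided_exp:
  assumes "e > 0"
  shows "(\<integral>\<^sup>+z. ennreal (exp (-e * \<bar>real_of_int z\<bar>)) \<partial>count_space UNIV)
           = ennreal ((1 + exp (-e)) / (1 - exp (-e)))"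
proof -
  let ?f = "\<lambda>z::int. ennreal (exp (-e * \<bar>real_of_int z\<bar>))"
  define q where "q = exp (-e)"
  have q: "0 < q" "q < 1" using assms by (auto simp: q_def)
  have pw: "exp (-e * real k) = q ^ k" for k :: nat
    by (simp add: q_def exp_of_nat2_mult[symmetric] mult.commute)
  have U: "(UNIV :: int set) = range int \<union> range (\<lambda>k. - int (Suc k))"
  proof -
    have "z \<in> range int \<union> range (\<lambda>k. - int (Suc k))" for z :: int
      by (cases z) auto
    thus ?thesis by auto
  qed
  have disj: "range int \<inter> range (\<lambda>k. - int (Suc k)) = {}" by auto
  have "(\<integral>\<^sup>+z. ?f z \<partial>count_space UNIV) = (\<integral>\<^sup>+z\<in>range int \<union> range (\<lambda>k. - int (Suc k)). ?f z \<partial>count_space UNIV)"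
    by (subst U[symmetric]) simp
  also have "\<dots> = (\<integral>\<^sup>+z\<in>range int. ?f z \<partial>count_space UNIV)
                 + (\<integral>\<^sup>+z\<in>range (\<lambda>k. - int (Suc k)). ?f z \<partial>count_space UNIV)"
    by (rule nn_integral_disjoint_pair_countspace[OF disj])
  also have "(\<integral>\<^sup>+z\<in>range int. ?f z \<partial>count_space UNIV) = (\<integral>\<^sup>+k. ?f (int k) \<partial>count_space UNIV)"
    by (subst nn_integral_count_compose_inj[symmetric]) (auto simp: inj_on_def)
  also have "\<dots> = (\<Sum>k. ennreal (q ^ k))"
    by (subst nn_integral_count_space_nat) (simp only: of_int_of_nat_eq abs_of_nat pw)
  also have "\<dots> = ennreal (1 / (1 - q))"
    using q by (intro suminf_ennreal_eq geometric_sums) auto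
  also have "(\<integral>\<^sup>+z\<in>range (\<lambda>k. - int (Suc k)). ?f z \<partial>count_space UNIV)
              = (\<integral>\<^sup>+k. ?f (- int (Suc k)) \<partial>count_space UNIV)"
    by (subst nn_integral_count_compose_inj[symmetric]) (auto simp: inj_on_def)
  also have "\<dots> = (\<Sum>k. ennreal (q * q ^ k))"
  proof (subst nn_integral_count_space_nat, rule arg_cong[of _ _ suminf], rule ext)
    fix k
    have "\<bar>real_of_int (- int (Suc k))\<bar> = real (Suc k)" by simp
    thus "?f (- int (Suc k)) = ennreal (q * q ^ k)"
      using pw[of "Suc k"] by (simp only: power_Suc)
  qed
  also have "\<dots> = ennreal (q * (1 / (1 - q)))"
    using q by (intro suminf_ennreal_eq sums_mult geometric_sums) auto
  also have "ennreal (1 / (1 - q)) + \<dots> = ennreal ((1 + q) / (1 - q))"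
    using q by (subst ennreal_plus[symmetric]) (auto simp: field_simps)
  finally show ?thesis by (simp add: q_def)
qed

lemma pmf_discrete_laplace:
  assumes "e > 0"
  shows "pmf (discrete_laplace e) z = (1 - exp (-e)) / (1 + exp (-e)) * exp (-e * \<bar>real_of_int z\<bar>)"
  unfolding discrete_laplace_def
proof (rule pmf_embed_pmf)
  have c: "(1 - exp (-e)) / (1 + exp (-e)) > 0"
    using assms by (intro divide_pos_pos) (auto intro: add_pos_pos)
  then show "0 \<le> (1 - exp (-e)) / (1 + exp (-e)) * exp (-e * \<bar>real_of_int x\<bar>)" for x
    by (intro mult_nonneg_nonneg) auto
  have "(\<integral>\<^sup>+x. ennreal ((1 - exp (-e)) / (1 + exp (-e)) * exp (-e * \<bar>real_of_int x\<bar>)) \<partial>count_space UNIV)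
      = ennreal ((1 - exp (-e)) / (1 + exp (-e))) * ennreal ((1 + exp (-e)) / (1 - exp (-e)))"
    using c by (simp only: ennreal_mult'[OF less_imp_le] nn_integral_two_sided_exp[OF assms, symmetric])
       (rule nn_integral_cmult, simp)
  also have "\<dots> = 1"
    using assms c add_pos_pos[OF zero_less_one exp_gt_zero[of "-e"]]
    by (subst ennreal_mult[symmetric]) (auto intro!: divide_nonneg_nonneg)
  finally show "(\<integral>\<^sup>+x. ennreal ((1 - exp (-e)) / (1 + exp (-e)) * exp (-e * \<bar>real_of_int x\<bar>)) \<partial>count_space UNIV) = 1" .
qed

text \<open>The triangle inequality \<open>|z + d| \<le> |z| + |d|\<close>, read in the
  exponent.\<close>

lemma pmf_discrete_laplace_shift:
  assumes "e > 0"
  shows "pmf (discrete_laplace e) z \<le> exp (e * \<bar>real_of_int d\<bar>) * pmf (discrete_laplace e) (z + d)"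
proof -
  have c: "(1 - exp (-e)) / (1 + exp (-e)) \<ge> 0"
    using assms by (intro divide_nonneg_nonneg) auto
  have "exp (-e * \<bar>real_of_int z\<bar>) \<le> exp (e * \<bar>real_of_int d\<bar>) * exp (-e * \<bar>real_of_int (z + d)\<bar>)"
  proof -
    have "e * \<bar>real_of_int (z + d)\<bar> \<le> e * (\<bar>real_of_int z\<bar> + \<bar>real_of_int d\<bar>)"
      using assms by (intro mult_left_mono) auto
    thus ?thesis by (simp add: exp_add[symmetric] algebra_simps)
  qed
  from mult_left_mono[OF this c] show ?thesis
    by (simp add: pmf_discrete_laplace[OF assms] algebra_simps)
qed

lemma discrete_laplace_symmetric: 
  assumes "e > 0"
  shows "map_pmf uminus (discrete_laplace e) = discrete_laplace e"
proof (rule pmf_eqI)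
  fix z :: int
  have "pmf (map_pmf uminus (discrete_laplace e)) (- (- z)) = pmf (discrete_laplace e) (- z)"
    by (rule pmf_map_inj') (auto simp: inj_on_def)
  thus "pmf (map_pmf uminus (discrete_laplace e)) z = pmf (discrete_laplace e) z"
    by (simp add: pmf_discrete_laplace[OF assms])
qed

lemma square_le_exp: "(x::real) \<ge> 0 \<Longrightarrow> x\<^sup>2 \<le> 2 * exp x"
  using exp_lower_Taylor_quadratic[of x] by (simp add: field_simps)

text \<open>The bound \<^term>\<open>16 / e\<^sup>2\<close> holds for all \<^term>\<open>e > 0\<close>, including large ones: the moment
  generating function at \<^term>\<open>e / 2\<close> never exceeds 2.\<close>
lemma nn_second_moment_discrete_laplace:
  assumes "e > 0"
  shows "(\<integral>\<^sup>+z. ennreal ((real_of_int z)\<^sup>2) \<partial>measure_pmf (discrete_laplace e)) \<le> ennreal (16 / e\<^sup>2)"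
proof -
  \<comment> \<open>Half of the decay rate absorbs the square; the other half leaves a two-sided
    geometric series of ratio \<open>p\<close>.\<close>
  define p where "p = exp (-(e/2))"
  have p: "0 < p" "p < 1" using assms by (auto simp: p_def)
  have pp: "exp (-e) = p\<^sup>2" by (simp add: p_def exp_double[symmetric])
  have c: "(1 - p\<^sup>2) / (1 + p\<^sup>2) \<ge> 0"
    using p by (intro divide_nonneg_nonneg) (auto simp: power_le_one)
  have "(\<integral>\<^sup>+z. ennreal ((real_of_int z)\<^sup>2) \<partial>measure_pmf (discrete_laplace e))
     = (\<integral>\<^sup>+z. ennreal (pmf (discrete_laplace e) z) * ennreal ((real_of_int z)\<^sup>2) \<partial>count_space UNIV)"
    by (rule nn_integral_measure_pmf)
  also have "\<dots> \<le> (\<integral>\<^sup>+z. ennreal (8 / e\<^sup>2 * ((1 - p\<^sup>2) / (1 + p\<^sup>2)))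
                       * ennreal (exp (-(e/2) * \<bar>real_of_int z\<bar>)) \<partial>count_space UNIV)"
  proof (rule nn_integral_mono)
    fix z :: int
    let ?a = "\<bar>real_of_int z\<bar>"
    have "(e / 2 * ?a)\<^sup>2 \<le> 2 * exp (e / 2 * ?a)"
      using assms by (intro square_le_exp) auto
    hence "(real_of_int z)\<^sup>2 \<le> 8 / e\<^sup>2 * exp (e / 2 * ?a)"
      using assms by (simp add: power_mult_distrib field_simps)
    hence "exp (-e * ?a) * (real_of_int z)\<^sup>2 \<le> exp (-e * ?a) * (8 / e\<^sup>2 * exp (e / 2 * ?a))"
      by (intro mult_left_mono) auto
    also have "\<dots> = 8 / e\<^sup>2 * (exp (-e * ?a) * exp (e / 2 * ?a))" by simp
    also have "exp (-e * ?a) * exp (e / 2 * ?a) = exp (-(e/2) * ?a)"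
      by (simp add: exp_add[symmetric])
    finally have "exp (-e * ?a) * (real_of_int z)\<^sup>2 \<le> 8 / e\<^sup>2 * exp (-(e/2) * ?a)" .
    from mult_left_mono[OF this c]
    have "pmf (discrete_laplace e) z * (real_of_int z)\<^sup>2
        \<le> 8 / e\<^sup>2 * ((1 - p\<^sup>2) / (1 + p\<^sup>2)) * exp (-(e/2) * ?a)"
      by (simp add: pmf_discrete_laplace[OF assms] pp algebra_simps)
    thus "ennreal (pmf (discrete_laplace e) z) * ennreal ((real_of_int z)\<^sup>2)
       \<le> ennreal (8 / e\<^sup>2 * ((1 - p\<^sup>2) / (1 + p\<^sup>2))) * ennreal (exp (-(e/2) * ?a))"
      using mult_nonneg_nonneg[OF _ c, of "8 / e\<^sup>2"]
      by (simp only: ennreal_mult[symmetric] pmf_nonneg zero_le_power2 exp_ge_zero ennreal_leI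
          zero_le_divide_iff zero_le_numeral simp_thms)
  qed
  also have "\<dots> = ennreal (8 / e\<^sup>2 * ((1 - p\<^sup>2) / (1 + p\<^sup>2))) * ennreal ((1 + p) / (1 - p))"
    using nn_integral_two_sided_exp[of "e/2"] assms
    by (subst nn_integral_cmult) (auto simp: p_def)
  also have "\<dots> = ennreal (8 / e\<^sup>2 * (((1 - p\<^sup>2) / (1 + p\<^sup>2)) * ((1 + p) / (1 - p))))"
    using p mult_nonneg_nonneg[OF _ c, of "8 / e\<^sup>2"]
    by (subst ennreal_mult[symmetric]) (simp_all only: mult.assoc, simp_all)
  also have "\<dots> \<le> ennreal (8 / e\<^sup>2 * 2)"
  proof (intro ennreal_leI mult_left_mono)
    have "((1 - p\<^sup>2) / (1 + p\<^sup>2)) * ((1 + p) / (1 - p)) = (1 + p)\<^sup>2 / (1 + p\<^sup>2)"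
      using p by (simp add: divide_simps power2_eq_square) (simp add: algebra_simps)?
    also have "\<dots> \<le> 2"
    proof -
      have "(1 + p)\<^sup>2 \<le> 2 * (1 + p\<^sup>2)"
        using zero_le_power2[of "1 - p"] by (simp add: power2_eq_square algebra_simps)
      moreover have "1 + p\<^sup>2 > 0" by (intro add_pos_nonneg) auto
      ultimately show ?thesis by (simp add: pos_divide_le_eq)
    qed
    finally show "((1 - p\<^sup>2) / (1 + p\<^sup>2)) * ((1 + p) / (1 - p)) \<le> 2" .
  qed auto
  finally show ?thesis by simp
qed

lemma
  assumes "e > 0"
  shows integrable_square_discrete_laplace:
      "integrable (measure_pmf (discrete_laplace e)) (\<lambda>z. (real_of_int z)\<^sup>2)"
    and second_moment_discrete_laplace:
      "measure_pmf.expectation (discrete_laplace e) (\<lambda>z. (real_of_int z)\<^sup>2) \<le> 16 / e\<^sup>2"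
proof -
  note nn = nn_second_moment_discrete_laplace[OF assms]
  show int: "integrable (measure_pmf (discrete_laplace e)) (\<lambda>z. (real_of_int z)\<^sup>2)"
    using le_less_trans[OF nn ennreal_less_top]
    by (intro integrableI_nonneg) auto
  show "measure_pmf.expectation (discrete_laplace e) (\<lambda>z. (real_of_int z)\<^sup>2) \<le> 16 / e\<^sup>2"
    using nn by (subst (asm) nn_integral_eq_integral[OF int]) (auto simp: ennreal_le_iff)
qed

lemma
  assumes "e > 0"
  shows integrable_discrete_laplace: "integrable (measure_pmf (discrete_laplace e)) real_of_int"
    and expectation_discrete_laplace: "measure_pmf.expectation (discrete_laplace e) real_of_int = 0"
proof -
  show "integrable (measure_pmf (discrete_laplace e)) real_of_int"
    by (rule measure_pmf.square_integrable_imp_integrable)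
       (use integrable_square_discrete_laplace[OF assms] in auto)
  have "measure_pmf.expectation (discrete_laplace e) real_of_int
      = measure_pmf.expectation (map_pmf uminus (discrete_laplace e)) real_of_int"
    by (simp only: discrete_laplace_symmetric[OF assms])
  also have "\<dots> = - measure_pmf.expectation (discrete_laplace e) real_of_int"
    by simp
  finally show "measure_pmf.expectation (discrete_laplace e) real_of_int = 0" by simp
qed

text \<open>The variables are independent with mean zero, so all cross terms vanish in expectation
  and only the diagonal contributes.\<close>

lemma
  fixes e :: "'i \<Rightarrow> real"
  assumes I: "finite I" and e: "\<And>i. i \<in> I \<Longrightarrow> e i > 0" and H: "H \<subseteq> I"
  defines "N \<equiv> Pi_pmf I 0 (\<lambda>i. discrete_laplace (e i))"
  shows integrable_square_sum_discrete_laplace: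
      "integrable (measure_pmf N) (\<lambda>z. (\<Sum>i\<in>H. real_of_int (z i))\<^sup>2)"
    and second_moment_sum_discrete_laplace:
      "measure_pmf.expectation N (\<lambda>z. (\<Sum>i\<in>H. real_of_int (z i))\<^sup>2) \<le> (\<Sum>i\<in>H. 16 / (e i)\<^sup>2)"
proof -
  have comp: "map_pmf (\<lambda>z. z i) N = discrete_laplace (e i)" if "i \<in> I" for i
    using that I by (simp add: N_def Pi_pmf_component)
  have int1: "integrable (measure_pmf N) (\<lambda>z. real_of_int (z i))"
    and ex1: "measure_pmf.expectation N (\<lambda>z. real_of_int (z i)) = 0"
    and int2: "integrable (measure_pmf N) (\<lambda>z. (real_of_int (z i))\<^sup>2)"
    and ex2: "measure_pmf.expectation N (\<lambda>z. (real_of_int (z i))\<^sup>2) \<le> 16 / (e i)\<^sup>2" if "i \<in> I" for i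
    using integrable_discrete_laplace[OF e[OF that]] expectation_discrete_laplace[OF e[OF that]]
      integrable_square_discrete_laplace[OF e[OF that]] second_moment_discrete_laplace[OF e[OF that]]
    by (simp_all add: comp[OF that, symmetric])
  have indep: "prob_space.indep_vars (measure_pmf N) (\<lambda>_. borel) (\<lambda>i z. real_of_int (z i)) I"
    unfolding N_def by (rule prob_space.indep_vars_compose2[OF measure_pmf.prob_space_axioms indep_vars_Pi_pmf[OF I]]) simp
  have cross: "integrable (measure_pmf N) (\<lambda>z. real_of_int (z i) * real_of_int (z k)) \<and>
        measure_pmf.expectation N (\<lambda>z. real_of_int (z i) * real_of_int (z k)) = 0"
    if "i \<in> I" "k \<in> I" "i \<noteq> k" for i k
  proof -
    have iv: "prob_space.indep_vars (measure_pmf N) (\<lambda>_. borel) (\<lambda>i z. real_of_int (z i)) {i, k}"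
      by (rule prob_space.indep_vars_subset[OF measure_pmf.prob_space_axioms indep]) (use that in auto)
    show ?thesis
      using prob_space.indep_vars_lebesgue_integral[OF measure_pmf.prob_space_axioms _ iv]
        prob_space.indep_vars_integrable[OF measure_pmf.prob_space_axioms _ iv]
        that int1 ex1 by auto
  qed
  have int: "integrable (measure_pmf N) (\<lambda>z. real_of_int (z i) * real_of_int (z k))"
    if "i \<in> I" "k \<in> I" for i k
    using cross[OF that] int2[of i] that by (cases "i = k") (auto simp: power2_eq_square)
  have fH: "finite H" using I H finite_subset by blast
  have expand: "(\<Sum>i\<in>H. real_of_int (z i))\<^sup>2 = (\<Sum>i\<in>H. \<Sum>k\<in>H. real_of_int (z i) * real_of_int (z k))"
    for z :: "'i \<Rightarrow> int"
    by (simp add: power2_eq_square sum_product)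
  show "integrable (measure_pmf N) (\<lambda>z. (\<Sum>i\<in>H. real_of_int (z i))\<^sup>2)"
    unfolding expand using H by (intro Bochner_Integration.integrable_sum int) auto
  have "measure_pmf.expectation N (\<lambda>z. (\<Sum>i\<in>H. real_of_int (z i))\<^sup>2)
      = (\<Sum>i\<in>H. \<Sum>k\<in>H. measure_pmf.expectation N (\<lambda>z. real_of_int (z i) * real_of_int (z k)))"
    unfolding expand using H
    by (simp add: Bochner_Integration.integral_sum Bochner_Integration.integrable_sum int subset_iff)
  also have "\<dots> = (\<Sum>i\<in>H. \<Sum>k\<in>H. if i = k then measure_pmf.expectation N (\<lambda>z. (real_of_int (z i))\<^sup>2) else 0)"
    using H cross by (intro sum.cong refl) (auto simp: power2_eq_square subset_iff)
  also have "\<dots> = (\<Sum>i\<in>H. measure_pmf.expectation N (\<lambda>z. (real_of_int (z i))\<^sup>2))"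
    using fH by (simp add: sum.delta)
  also have "\<dots> \<le> (\<Sum>i\<in>H. 16 / (e i)\<^sup>2)"
    using H by (intro sum_mono ex2) auto
  finally show "measure_pmf.expectation N (\<lambda>z. (\<Sum>i\<in>H. real_of_int (z i))\<^sup>2) \<le> (\<Sum>i\<in>H. 16 / (e i)\<^sup>2)" .
qed

section \<open>Chebyshev bound and privacy of shifted product noise\<close>

lemma prob_abs_ge_second_moment:
  fixes f :: "'a \<Rightarrow> real"
  assumes int: "integrable (measure_pmf p) (\<lambda>x. (f x)\<^sup>2)" and b: "b > 0"
  shows "measure_pmf.prob p {x. b \<le> \<bar>f x\<bar>} \<le> measure_pmf.expectation p (\<lambda>x. (f x)\<^sup>2) / b\<^sup>2"
proof -
  have "{x. b \<le> \<bar>f x\<bar>} = {x \<in> space (measure_pmf p). b\<^sup>2 \<le> (f x)\<^sup>2}"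
    using b by (auto simp: abs_le_square_iff[symmetric])
  with integral_Markov_inequality_measure[OF int, of "{}" "b\<^sup>2"] b show ?thesis
    by simp
qed

lemma measure_pmf_mono_pmf:
  assumes "\<And>x. pmf p x \<le> c * pmf q x" "c \<ge> 0"
  shows "measure_pmf.prob p S \<le> c * measure_pmf.prob q S"
proof -
  have "emeasure (measure_pmf p) S = (\<integral>\<^sup>+x. pmf p x \<partial>count_space S)"
    by (simp add: nn_integral_pmf)
  also have "\<dots> \<le> (\<integral>\<^sup>+x. ennreal c * ennreal (pmf q x) \<partial>count_space S)"
    using assms by (intro nn_integral_mono) (auto simp: ennreal_mult[symmetric] intro!: ennreal_leI)
  also have "\<dots> = ennreal c * emeasure (measure_pmf q) S"
    by (subst nn_integral_cmult) (auto simp: nn_integral_pmf)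
  finally show ?thesis
    using assms by (simp add: measure_pmf.emeasure_eq_measure ennreal_mult[symmetric])
qed

text \<open>The likelihood ratios of the coordinates multiply, so their costs
  \<open>e i * |d i|\<close> add up in the exponent: composition over all noise variables at once.
  \<open>d\<close> vanishes off \<open>I\<close> because \<open>Pi_pmf\<close> fixes those
  coordinates to 0, and a shift there would leave the support.\<close>

lemma discrete_laplace_mechanism:
  fixes e :: "'i \<Rightarrow> real" and d :: "'i \<Rightarrow> int"
  assumes I: "finite I" and e: "\<And>i. i \<in> I \<Longrightarrow> e i > 0" and d: "\<And>i. i \<notin> I \<Longrightarrow> d i = 0"
    and le: "(\<Sum>i\<in>I. e i * \<bar>real_of_int (d i)\<bar>) \<le> eps"
  defines "N \<equiv> Pi_pmf I 0 (\<lambda>i. discrete_laplace (e i))"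
  shows "measure_pmf.prob N {z. (\<lambda>i. z i + d i) \<in> S} \<le> exp eps * measure_pmf.prob N S"
proof -
  let ?sh = "\<lambda>z i. z i + d i"
  have bij: "inj ?sh" by (auto simp: inj_def fun_eq_iff)
  have "pmf (map_pmf ?sh N) y \<le> exp eps * pmf N y" for y
  proof -
    have y: "y = ?sh (\<lambda>i. y i - d i)" by auto
    have "pmf (map_pmf ?sh N) y = pmf N (\<lambda>i. y i - d i)"
      by (subst y, rule pmf_map_inj'[OF bij])
    also have "\<dots> \<le> exp eps * pmf N y"
    proof (cases "\<forall>i. i \<notin> I \<longrightarrow> y i = 0")
      case False
      hence "pmf N (\<lambda>i. y i - d i) = 0"
        using I d unfolding N_def by (subst pmf_Pi) auto
      thus ?thesis by simp
    next
      case True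
      hence "pmf N (\<lambda>i. y i - d i) = (\<Prod>i\<in>I. pmf (discrete_laplace (e i)) (y i - d i))"
        using I d unfolding N_def by (subst pmf_Pi) auto
      also have "\<dots> \<le> (\<Prod>i\<in>I. exp (e i * \<bar>real_of_int (d i)\<bar>) * pmf (discrete_laplace (e i)) (y i))"
      proof (intro prod_mono conjI pmf_nonneg)
        fix i assume "i \<in> I"
        from pmf_discrete_laplace_shift[OF e[OF this], of "y i - d i" "d i"]
        show "pmf (discrete_laplace (e i)) (y i - d i)
            \<le> exp (e i * \<bar>real_of_int (d i)\<bar>) * pmf (discrete_laplace (e i)) (y i)" by simp
      qed
      also have "\<dots> = exp (\<Sum>i\<in>I. e i * \<bar>real_of_int (d i)\<bar>) * pmf N y"
        using I True unfolding N_def by (subst pmf_Pi) (auto simp: prod.distrib exp_sum)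
      also have "\<dots> \<le> exp eps * pmf N y"
        using le by (intro mult_right_mono) auto
      finally show ?thesis .
    qed
    finally show ?thesis .
  qed
  from measure_pmf_mono_pmf[OF this, of S] show ?thesis
    by (simp add: vimage_def)
qed

section \<open>Monotone symmetric norms\<close>

lemma
  assumes "mon_sym_norm n L" and x: "x \<in> vecs n"
  shows mon_sym_norm_scale: "L (\<lambda>i. c * x i) = \<bar>c\<bar> * L x"
    and mon_sym_norm_triangle: "y \<in> vecs n \<Longrightarrow> L (\<lambda>i. x i + y i) \<le> L x + L y"
    and mon_sym_norm_mono: "y \<in> vecs n \<Longrightarrow> (\<And>i. i < n \<Longrightarrow> \<bar>x i\<bar> \<le> \<bar>y i\<bar>) \<Longrightarrow> L x \<le> L y"
    and mon_sym_norm_permute: "p permutes {..<n} \<Longrightarrow> L (x \<circ> p) = L x"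
    and mon_sym_norm_nonneg: "L x \<ge> 0"
  using assms
  by (simp_all add: mon_sym_norm_def is_norm_on_def monotone_norm_def symmetric_norm_def)

lemma norm_single_coordinate:
  assumes L: "mon_sym_norm n L" and k: "k < n"
  shows "L (\<lambda>i. if i = k then c else 0) = \<bar>c\<bar> * L e1"
proof -
  have e1: "e1 \<in> vecs n" using k by (auto simp: e1_def vecs_def)
  have "Transposition.transpose 0 k permutes {..<n}"
    by (rule permutes_swap_id) (use k in auto)
  hence "L (e1 \<circ> Transposition.transpose 0 k) = L e1"
    by (rule mon_sym_norm_permute[OF L e1])
  moreover have "e1 \<circ> Transposition.transpose 0 k = (\<lambda>i. if i = k then 1 else 0)"
    by (auto simp: e1_def fun_eq_iff Transposition.transpose_def)
  moreover have "L (\<lambda>i. c * (if i = k then 1 else 0)) = \<bar>c\<bar> * L (\<lambda>i. if i = k then 1 else 0)"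
    by (rule mon_sym_norm_scale[OF L]) (use k in \<open>simp add: vecs_def\<close>)
  moreover have "(\<lambda>i. c * (if i = k then 1 else 0)) = (\<lambda>i. if i = k then c else 0)"
    by auto
  ultimately show ?thesis by simp
qed

text \<open>The triangle inequality adds one coordinate at a time. This is where \<open>L e1\<close>
  becomes the unit of the additive error.\<close>

lemma norm_le_sum_abs:
  assumes L: "mon_sym_norm n L" and x: "x \<in> vecs n"
  shows "L x \<le> (\<Sum>i<n. \<bar>x i\<bar>) * L e1"
proof -
  have "L (\<lambda>i. if i < k then x i else 0) \<le> (\<Sum>i<k. \<bar>x i\<bar>) * L e1" if "k \<le> n" for k
    using that
  proof (induction k)
    case 0
    have "(\<lambda>_. 0) \<in> vecs n" by (simp add: vecs_def)
    hence "L (\<lambda>_. 0) = 0" using L by (auto simp: mon_sym_norm_def is_norm_on_def)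
    thus ?case by simp
  next
    case (Suc k)
    let ?y = "\<lambda>i. if i < k then x i else 0" and ?d = "\<lambda>i. if i = k then x k else 0"
    have "?y \<in> vecs n" "?d \<in> vecs n" using Suc.prems by (auto simp: vecs_def)
    hence "L (\<lambda>i. ?y i + ?d i) \<le> L ?y + L ?d"
      by (rule mon_sym_norm_triangle[OF L])
    moreover have "(\<lambda>i. ?y i + ?d i) = (\<lambda>i. if i < Suc k then x i else 0)"
      by (auto simp: less_Suc_eq)
    ultimately show ?case
      using Suc norm_single_coordinate[OF L, of k "x k"] by (simp add: algebra_simps)
  qed
  from this[of n] have "L (\<lambda>i. if i < n then x i else 0) \<le> (\<Sum>i<n. \<bar>x i\<bar>) * L e1" by simp
  moreover have "(\<lambda>i. if i < n then x i else 0) = x" using x by (auto simp: vecs_def)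
  ultimately show ?thesis by simp
qed

text \<open>Turns a coordinatewise estimate into one valid for every norm: the factor
  \<open>c\<close> passes through by homogeneity, and the remainder \<open>r\<close> costs only its
  l1 mass in units of \<open>L e1\<close>.\<close>

lemma norm_le_additive_slack:
  assumes L: "mon_sym_norm n L" and x: "x \<in> vecs n" and y: "y \<in> vecs n" and r: "r \<in> vecs n"
    and le: "\<And>i. i < n \<Longrightarrow> \<bar>x i\<bar> \<le> c * y i + r i" and c: "c \<ge> 0" and r0: "\<And>i. r i \<ge> 0"
    and s: "(\<Sum>i<n. r i) \<le> s" and n: "n \<ge> 1"
  shows "L x \<le> c * L y + s * L e1"
proof -
  let ?cy = "\<lambda>i. c * y i"
  have cy: "?cy \<in> vecs n" "(\<lambda>i. ?cy i + r i) \<in> vecs n" using y r by (auto simp: vecs_def)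
  have "L x \<le> L (\<lambda>i. ?cy i + r i)"
    by (rule mon_sym_norm_mono[OF L x cy(2)]) (use le in force)
  also have "\<dots> \<le> L ?cy + L r"
    by (rule mon_sym_norm_triangle[OF L cy(1) r])
  also have "L ?cy = c * L y"
    using mon_sym_norm_scale[OF L y] c by simp
  also have "L r \<le> (\<Sum>i<n. \<bar>r i\<bar>) * L e1" by (rule norm_le_sum_abs[OF L r])
  also have "\<dots> \<le> s * L e1"
  proof (intro mult_right_mono)
    show "(\<Sum>i<n. \<bar>r i\<bar>) \<le> s" using r0 s by simp
    have "e1 \<in> vecs n" using n by (auto simp: e1_def vecs_def)
    thus "L e1 \<ge> 0" by (rule mon_sym_norm_nonneg[OF L])
  qed
  finally show ?thesis by simp
qed

section \<open>The level grid and reconstruction from layer masses\<close>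

text \<open>The summand 1 makes the grid advance by single integers as long as
  \<open>z * level z j < 1\<close>, and the floor keeps all levels integral. The increment is
  spelled out because \<open>width\<close> refers back to \<open>level\<close>.\<close>

fun level :: "real \<Rightarrow> nat \<Rightarrow> nat" where
  "level z 0 = 0"
| "level z (Suc j) = level z j + (1 + nat \<lfloor>z * level z j\<rfloor>)"

definition width :: "real \<Rightarrow> nat \<Rightarrow> nat" where
  "width z j = 1 + nat \<lfloor>z * level z j\<rfloor>"

lemma level_Suc: "level z (Suc j) = level z j + width z j"
  by (simp add: width_def)

declare level.simps(2) [simp del]

lemma width_pos [simp]: "width z j > 0"
  by (simp add: width_def)

lemma sum_width: "(\<Sum>j<J. width z j) = level z J"
  by (induction J) (simp_all add: level_Suc)

text \<open>Every layer has width at least 1, so \<open>T\<close> layers cover all frequencies up to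
  \<open>T\<close>. So many layers are affordable because the final error bound does not depend on
  their number.\<close>

lemma le_level: "j \<le> level z j"
proof (induction j)
  case (Suc j)
  thus ?case using width_pos[of z j] unfolding level_Suc by linarith
qed simp

lemma level_mono: "i \<le> j \<Longrightarrow> level z i \<le> level z j"
  by (rule lift_Suc_mono_le[of "level z"]) (simp_all add: level_Suc)

lemma width_le: "z > 0 \<Longrightarrow> real (width z j) \<le> 1 + z * level z j"
  by (simp add: width_def)

lemma width_gt: "z > 0 \<Longrightarrow> z * level z j < real (width z j)"
  by (simp add: width_def) linarith

lemma level_ge_power:
  assumes "z > 0"
  shows "(1 + z) ^ j \<le> real (level z (Suc j))"
proof (induction j)
  case 0
  show ?case by (simp add: level_Suc width_def)
next
  case (Suc j)
  have "(1 + z) ^ Suc j \<le> (1 + z) * real (level z (Suc j))"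
    using Suc assms by simp
  also have "\<dots> \<le> real (level z (Suc (Suc j)))"
    using width_gt[OF assms, of "Suc j"] level_Suc[of z "Suc j"] by (simp add: algebra_simps)
  finally show ?case .
qed

text \<open>\<open>width z j\<close> exceeds \<open>z * level z j\<close>, and
  \<open>level z j\<close> is at least the power with exponent \<open>j - 1\<close>; the factor
  \<open>1 + z\<close> on the right makes up for the missing power.\<close>

lemma width_ge_power:
  assumes z: "z > 0"
  shows "z * (1 + z) ^ j \<le> (1 + z) * real (width z j)"
proof (cases j)
  case 0
  thus ?thesis by (simp add: width_def)
next
  case (Suc i)
  have "z * (1 + z) ^ j = (1 + z) * (z * (1 + z) ^ i)" by (simp add: Suc)
  also have "z * (1 + z) ^ i \<le> z * level z j"
    unfolding Suc using level_ge_power[OF z, of i] z by (intro mult_left_mono) auto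
  also have "\<dots> \<le> width z j" using width_gt[OF z, of j] by simp
  finally show ?thesis using z by simp
qed

text \<open>The layers that start below \<open>m\<close> form an initial segment, whose widths sum
  to the level at which the last of them ends. Only that last layer can overshoot \<open>m\<close>,
  by a relative error of at most \<open>z\<close>.\<close>

lemma sum_width_below_le:
  assumes z: "z > 0"
  shows "(\<Sum>j<J. real (width z j) * of_bool (level z j < m)) \<le> (1 + z) * real m"
proof (induction J)
  case 0
  show ?case using z by simp
next
  case (Suc J)
  show ?case
  proof (cases "level z J < m")
    case False
    with Suc show ?thesis by simp
  next
    case True
    have "(\<Sum>j<Suc J. real (width z j) * of_bool (level z j < m)) = (\<Sum>j<Suc J. real (width z j))"
    proof (intro sum.cong refl)
      fix j assume "j \<in> {..<Suc J}"
      hence "level z j \<le> level z J" by (intro level_mono) auto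
      with True show "real (width z j) * of_bool (level z j < m) = real (width z j)" by simp
    qed
    also have "\<dots> = real (level z (Suc J))"
      by (simp only: of_nat_sum[symmetric] sum_width)
    also have "\<dots> \<le> real (level z J) + 1 + z * level z J"
      using width_le[OF z, of J] by (simp add: level_Suc)
    \<comment> \<open>Integrality turns \<open>level z J < m\<close> into
      \<open>level z J + 1 \<le> m\<close>, which absorbs the 1 in the width.\<close>
    also have "\<dots> \<le> real m + z * real m"
      using True z by (intro add_mono mult_left_mono) auto
    finally show ?thesis by (simp add: algebra_simps)
  qed
qed

lemma sum_width_below_ge:
  assumes z: "z > 0" and "m \<le> level z J"
  shows "real m \<le> (1 + z) * (\<Sum>j<J. real (width z j) * of_bool (level z (Suc j) \<le> m))"
  using assms(2)
proof (induction J)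
  case (Suc J)
  let ?s = "\<lambda>J. \<Sum>j<J. real (width z j) * of_bool (level z (Suc j) \<le> m)"
  have all: "?s K = real (level z K)" if "level z K \<le> m" for K
  proof -
    have "?s K = (\<Sum>j<K. real (width z j))"
    proof (intro sum.cong refl)
      fix j assume "j \<in> {..<K}"
      hence "level z (Suc j) \<le> level z K" by (intro level_mono) auto
      with that show "real (width z j) * of_bool (level z (Suc j) \<le> m) = real (width z j)" by simp
    qed
    thus ?thesis by (simp only: of_nat_sum[symmetric] sum_width)
  qed
  consider "m = level z (Suc J)" | "m \<le> level z J" | "level z J < m" "m < level z (Suc J)"
    using Suc.prems by linarith
  thus ?case
  proof cases
    case 1
    thus ?thesis using all[of "Suc J"] z by (simp add: mult_le_cancel_right1)
  next
    case 2
    have "?s J \<le> ?s (Suc J)" by simp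
    with Suc.IH[OF 2] z show ?thesis
      by (smt (verit, best) mult_left_mono)
  next
    case 3
    \<comment> \<open>Here \<open>m\<close> lies strictly inside layer \<open>J\<close>, so at most
      \<open>width z J - 1 \<le> z * level z J\<close> of it is lost.\<close>
    have "real m \<le> real (level z J) + (real (width z J) - 1)"
      using 3 by (simp add: level_Suc)
    also have "\<dots> \<le> (1 + z) * real (level z J)"
      using width_le[OF z, of J] by (simp add: algebra_simps)
    also have "real (level z J) = ?s (Suc J)"
      using all[of J] 3 by simp
    finally show ?thesis .
  qed
qed simp

definition layer_mass :: "nat \<Rightarrow> nat \<Rightarrow> nat \<Rightarrow> (nat \<Rightarrow> nat) \<Rightarrow> int" where
  "layer_mass n a b g = (\<Sum>i<n. int (min (g i) b) - int (min (g i) a))"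

section \<open>Coordinates spoiled by noise, and the norm of the reconstruction\<close>

lemma down_closed_eq_lessThan_card:
  fixes A :: "nat set"
  assumes "finite A" "\<And>i k. k \<in> A \<Longrightarrow> i \<le> k \<Longrightarrow> i \<in> A"
  shows "A = {..<card A}"
proof (cases "A = {}")
  case False
  have "A = {..Max A}" 
  proof (intro equalityI subsetI)
    fix i assume "i \<in> {..Max A}"
    thus "i \<in> A" using assms(2)[OF Max_in[OF assms(1) False], of i] by simp
  qed (use assms(1) in simp)
  thus ?thesis by (metis card_atMost lessThan_Suc_atMost)
qed simp

text \<open>A nonempty \<open>U\<close> forces \<open>2 * \<beta> \<ge> 1\<close>, so the linear
  bound \<open>2 * \<beta>\<close> may be squared. With \<open>\<beta> = B / w\<close> the square
  makes the error \<open>w * 4 * (B / w)^2\<close> shrink as the layer gets wider.\<close>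

lemma card_le_four_square:
  fixes \<beta> :: real
  assumes "U \<noteq> {} \<Longrightarrow> real (card U) \<le> \<beta> + 1/2" "U \<noteq> {} \<Longrightarrow> \<beta> \<ge> 1/2"
  shows "real (card U) \<le> 4 * \<beta>\<^sup>2"
proof (cases "U = {}")
  case False
  hence "real (card U) \<le> 2 * \<beta> * 1" using assms by simp
  also have "\<dots> \<le> 2 * \<beta> * (2 * \<beta>)" using assms False by (intro mult_left_mono) auto
  finally show ?thesis by (simp add: power2_eq_square)
qed simp

text \<open>Since \<open>g\<close> is sorted, the coordinates above \<open>a\<close> and those at or
  above \<open>b\<close> are prefixes of lengths \<open>N\<close> and \<open>M\<close>, and the mass
  lies between \<open>w * M\<close> and \<open>w * N\<close>. By the offset 1/2, a wrong decision
  \<open>k\<close> places away from a prefix end needs noise at least \<open>w * (k + 1/2)\<close>.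
  Coordinates with \<open>a < g i < b\<close> may go either way and are left to the rounding
  error.\<close>

lemma
  fixes eta B w x :: real
  assumes ab: "a < b"
    and anti: "\<And>i k. i \<le> k \<Longrightarrow> k < n \<Longrightarrow> g k \<le> g i"
    and eta: "\<bar>eta\<bar> \<le> B"
  defines "w \<equiv> real b - real a" and "x \<equiv> real_of_int (layer_mass n a b g) + eta"
  shows card_overcounted: "w * card {i. i < n \<and> w * (i + 1/2) \<le> x \<and> g i \<le> a} \<le> 4 * B\<^sup>2 / w"
    and card_undercounted: "w * card {i. i < n \<and> \<not> w * (i + 1/2) \<le> x \<and> b \<le> g i} \<le> 4 * B\<^sup>2 / w"
proof -
  have w: "w > 0" using ab by (simp add: w_def)
  have scale: "w * real c \<le> 4 * B\<^sup>2 / w" if "real c \<le> 4 * (B / w)\<^sup>2" for c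
    using mult_left_mono[OF that, of w] w by (simp add: power2_eq_square)
  let ?U = "{i. i < n \<and> w * (i + 1/2) \<le> x \<and> g i \<le> a}"
  let ?V = "{i. i < n \<and> \<not> w * (i + 1/2) \<le> x \<and> b \<le> g i}"
  define N where "N = card {i. i < n \<and> a < g i}"
  define M where "M = card {i. i < n \<and> b \<le> g i}"
  have N: "{i. i < n \<and> a < g i} = {..<N}"
    unfolding N_def
  proof (rule down_closed_eq_lessThan_card)
    fix i k assume "k \<in> {i. i < n \<and> a < g i}" "i \<le> k"
    thus "i \<in> {i. i < n \<and> a < g i}" using anti[of i k] by simp
  qed simp
  have M: "{i. i < n \<and> b \<le> g i} = {..<M}"
    unfolding M_def
  proof (rule down_closed_eq_lessThan_card)
    fix i k assume "k \<in> {i. i < n \<and> b \<le> g i}" "i \<le> k"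
    thus "i \<in> {i. i < n \<and> b \<le> g i}" using anti[of i k] by simp
  qed simp
  have S: "real_of_int (layer_mass n a b g) = (\<Sum>i<n. real (min (g i) b) - real (min (g i) a))"
    by (simp add: layer_mass_def)
  have "real_of_int (layer_mass n a b g) \<le> (\<Sum>i<n. if a < g i then w else 0)"
    unfolding S w_def using ab by (intro sum_mono) auto
  also have "\<dots> = w * real N"
    by (simp add: sum.If_cases N_def Int_def conj_commute)
  finally have SN: "real_of_int (layer_mass n a b g) \<le> w * real N" .
  have "w * real M = (\<Sum>i<n. if b \<le> g i then w else 0)"
    by (simp add: sum.If_cases M_def Int_def conj_commute)
  also have "\<dots> \<le> real_of_int (layer_mass n a b g)"
    unfolding S w_def using ab by (intro sum_mono) auto
  finally have SM: "w * real M \<le> real_of_int (layer_mass n a b g)" .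
  have U: "N \<le> i \<and> real i - real N + 1/2 \<le> B / w" if "i \<in> ?U" for i
  proof
    have "i \<notin> {i. i < n \<and> a < g i}" using that by simp
    thus "N \<le> i" unfolding N by simp
    have "(real i - real N + 1/2) * w \<le> B"
      using that SN eta by (auto simp: x_def algebra_simps)
    thus "real i - real N + 1/2 \<le> B / w" using w by (simp only: pos_le_divide_eq)
  qed
  have V: "i < M \<and> real M - real i - 1/2 \<le> B / w" if "i \<in> ?V" for i
  proof
    have "i \<in> {i. i < n \<and> b \<le> g i}" using that by simp
    thus "i < M" unfolding M by simp
    have "(real M - real i - 1/2) * w \<le> B"
      using that SM eta by (auto simp: x_def algebra_simps)
    thus "real M - real i - 1/2 \<le> B / w" using w by (simp only: pos_le_divide_eq)
  qed
  have "real (card ?U) \<le> 4 * (B / w)\<^sup>2"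
  proof (rule card_le_four_square)
    assume ne: "?U \<noteq> {}"
    define m where "m = Max ?U"
    have m: "m \<in> ?U" unfolding m_def using ne by (intro Max_in) auto
    have "?U \<subseteq> {N..m}"
    proof
      fix i assume i: "i \<in> ?U"
      hence "i \<le> m" unfolding m_def by (intro Max_ge) auto
      with U[OF i] show "i \<in> {N..m}" by simp
    qed
    hence "card ?U \<le> Suc m - N" using card_mono[of "{N..m}" ?U] by simp
    moreover have "N \<le> m" "real m - real N + 1/2 \<le> B / w" using U[OF m] by blast+
    ultimately show "real (card ?U) \<le> B / w + 1/2" "B / w \<ge> 1/2" by linarith+
  qed
  thus "w * card ?U \<le> 4 * B\<^sup>2 / w" by (rule scale)
  have "real (card ?V) \<le> 4 * (B / w)\<^sup>2"
  proof (rule card_le_four_square)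
    assume ne: "?V \<noteq> {}"
    define m where "m = Min ?V"
    have m: "m \<in> ?V" unfolding m_def using ne by (intro Min_in) auto
    have "?V \<subseteq> {m..<M}"
    proof
      fix i assume i: "i \<in> ?V"
      hence "m \<le> i" unfolding m_def by (intro Min_le) auto
      with V[OF i] show "i \<in> {m..<M}" by simp
    qed
    hence "card ?V \<le> M - m" using card_mono[of "{m..<M}" ?V] by simp
    moreover have "m < M" "real M - real m - 1/2 \<le> B / w" using V[OF m] by blast+
    ultimately show "real (card ?V) \<le> B / w + 1/2" "B / w \<ge> 1/2" by linarith+
  qed
  thus "w * card ?V \<le> 4 * B\<^sup>2 / w" by (rule scale)
qed

text \<open>The test says that \<open>i\<close> lies below \<open>x j / width z j\<close> rounded to
  the nearest integer, an estimate of how many coordinates reach through layer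
  \<open>j\<close>.\<close>

definition layer_sum :: "real \<Rightarrow> nat \<Rightarrow> nat \<Rightarrow> (nat \<Rightarrow> real) \<Rightarrow> nat \<Rightarrow> real" where
  "layer_sum z J n x i =
     (if i < n then \<Sum>j<J. real (width z j) * of_bool (width z j * (i + 1/2) \<le> x j) else 0)"

lemma
  assumes z: "z > 0" and n: "n \<ge> 1" and L: "mon_sym_norm n L"
    and anti: "\<And>i k. i \<le> k \<Longrightarrow> k < n \<Longrightarrow> g k \<le> g i"
    and supp: "\<And>i. i \<ge> n \<Longrightarrow> g i = 0" and gJ: "\<And>i. g i \<le> J"
    and eta: "\<And>j. j < J \<Longrightarrow> \<bar>eta j\<bar> \<le> B j"
    and \<alpha>: "(\<Sum>j<J. 4 * (B j)\<^sup>2 / width z j) \<le> \<alpha>"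
  defines "E \<equiv> layer_sum z J n
     (\<lambda>j. real_of_int (layer_mass n (level z j) (level z (Suc j)) g) + eta j)"
  shows layer_sum_norm_le: "L E \<le> (1 + z) * L (\<lambda>i. real (g i)) + \<alpha> * L e1"
    and layer_sum_norm_ge: "L (\<lambda>i. real (g i)) / (1 + z) - \<alpha> * L e1 \<le> L E"
proof -
  let ?x = "\<lambda>j. real_of_int (layer_mass n (level z j) (level z (Suc j)) g) + eta j"
  let ?hit = "\<lambda>j i. width z j * (real i + 1/2) \<le> ?x j"
  let ?U = "\<lambda>j. {i. i < n \<and> ?hit j i \<and> g i \<le> level z j}"
  let ?V = "\<lambda>j. {i. i < n \<and> \<not> ?hit j i \<and> level z (Suc j) \<le> g i}"
  \<comment> \<open>\<open>R A i\<close> is the total width of the layers in which coordinate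
    \<open>i\<close> is decided wrongly, with \<open>A\<close> either \<open>?U\<close> (spurious
    hits) or \<open>?V\<close> (missed hits). It serves as the slack vector.\<close>
  define R where "R A i = (\<Sum>j<J. real (width z j) * of_bool (i \<in> A j))" for A :: "nat \<Rightarrow> nat set" and i
  have w: "real (level z (Suc j)) - real (level z j) = width z j" for j
    by (simp add: level_Suc)
  have lt: "level z j < level z (Suc j)" for j by (simp add: level_Suc)
  have U: "real (width z j) * real (card (?U j)) \<le> 4 * (B j)\<^sup>2 / width z j"
   and V: "real (width z j) * real (card (?V j)) \<le> 4 * (B j)\<^sup>2 / width z j" if "j < J" for j
    using card_overcounted[OF lt anti eta[OF that]] card_undercounted[OF lt anti eta[OF that]]
    by (simp_all add: w)
  have R: "(\<Sum>i<n. R A i) \<le> \<alpha>" "R A \<in> vecs n" "\<And>i. R A i \<ge> 0"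
    if A: "\<And>j. A j \<subseteq> {..<n}"
      "\<And>j. j < J \<Longrightarrow> real (width z j) * card (A j) \<le> 4 * (B j)\<^sup>2 / width z j" for A
  proof -
    \<comment> \<open>Double counting: after exchanging the sums, the cardinality bound of each
      layer applies.\<close>
    have "(\<Sum>i<n. R A i) = (\<Sum>j<J. real (width z j) * (\<Sum>i<n. of_bool (i \<in> A j)))"
      unfolding R_def sum_distrib_left by (rule sum.swap)
    also have "\<dots> = (\<Sum>j<J. real (width z j) * card (A j))"
    proof (intro sum.cong refl)
      fix j
      have "{..<n} \<inter> {i. i \<in> A j} = A j" using A(1)[of j] by blast
      thus "real (width z j) * (\<Sum>i<n. of_bool (i \<in> A j)) = real (width z j) * card (A j)"
        by (simp only: sum_of_bool_eq finite_lessThan)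
    qed
    also have "\<dots> \<le> (\<Sum>j<J. 4 * (B j)\<^sup>2 / width z j)"
      using A(2) by (intro sum_mono) auto
    finally show "(\<Sum>i<n. R A i) \<le> \<alpha>" using \<alpha> by simp
    show "R A \<in> vecs n" unfolding vecs_def
    proof safe
      fix i assume "i \<ge> n"
      hence "i \<notin> A j" for j using A(1)[of j] by auto
      thus "R A i = 0" by (simp add: R_def)
    qed
    show "R A i \<ge> 0" for i by (auto simp: R_def intro!: sum_nonneg)
  qed
  have Ev: "E \<in> vecs n" by (auto simp: E_def layer_sum_def vecs_def)
  have gv: "(\<lambda>i. real (g i)) \<in> vecs n" using supp by (auto simp: vecs_def)
  have E0: "E i \<ge> 0" for i by (auto simp: E_def layer_sum_def intro!: sum_nonneg)
  show "L E \<le> (1 + z) * L (\<lambda>i. real (g i)) + \<alpha> * L e1"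
  proof (rule norm_le_additive_slack[OF L Ev gv])
    show "R ?U \<in> vecs n" "(\<Sum>i<n. R ?U i) \<le> \<alpha>" "\<And>i. R ?U i \<ge> 0"
      using R[of ?U, OF _ U] by auto
    fix i assume i: "i < n"
    have "E i \<le> (\<Sum>j<J. real (width z j) * of_bool (level z j < g i) + real (width z j) * of_bool (i \<in> ?U j))"
      unfolding E_def layer_sum_def if_P[OF i]
    proof (intro sum_mono)
      fix j
      \<comment> \<open>Every hit is genuine, with the layer starting below \<open>g i\<close>, or
        spurious.\<close>
      show "real (width z j) * of_bool (?hit j i)
          \<le> real (width z j) * of_bool (level z j < g i) + real (width z j) * of_bool (i \<in> ?U j)"
        using i by (cases "?hit j i"; cases "level z j < g i") simp_all
    qed
    also have "\<dots> \<le> (1 + z) * real (g i) + R ?U i"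
      using sum_width_below_le[OF z, where J = J and m = "g i"] by (simp add: sum.distrib R_def)
    finally show "\<bar>E i\<bar> \<le> (1 + z) * real (g i) + R ?U i" using E0 by simp
  qed (use z n in auto)
  \<comment> \<open>For the lower bound the roles are exchanged: \<open>g\<close> scaled by
    \<open>1 / (1 + z)\<close> is dominated by \<open>E\<close> plus the missed hits.\<close>
  let ?h = "\<lambda>i. 1 / (1 + z) * real (g i)"
  have "L ?h \<le> 1 * L E + \<alpha> * L e1"
  proof (rule norm_le_additive_slack[OF L _ Ev])
    show "R ?V \<in> vecs n" "(\<Sum>i<n. R ?V i) \<le> \<alpha>" "\<And>i. R ?V i \<ge> 0"
      using R[of ?V, OF _ V] by auto
    show "?h \<in> vecs n" using gv by (auto simp: vecs_def)
    fix i assume i: "i < n"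
    have "real (g i) \<le> (1 + z) * (\<Sum>j<J. real (width z j) * of_bool (level z (Suc j) \<le> g i))"
      using gJ[of i] le_level[of J z] by (intro sum_width_below_ge[OF z]) simp
    hence "\<bar>?h i\<bar> \<le> (\<Sum>j<J. real (width z j) * of_bool (level z (Suc j) \<le> g i))"
      using z by (simp add: pos_divide_le_eq mult.commute)
    also have "\<dots> \<le> (\<Sum>j<J. real (width z j) * of_bool (?hit j i) + real (width z j) * of_bool (i \<in> ?V j))"
    proof (intro sum_mono)
      fix j
      show "real (width z j) * of_bool (level z (Suc j) \<le> g i)
          \<le> real (width z j) * of_bool (?hit j i) + real (width z j) * of_bool (i \<in> ?V j)"
        using i by (cases "?hit j i"; cases "level z (Suc j) \<le> g i") simp_all
    qed
    also have "\<dots> = 1 * E i + R ?V i"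
      using i by (simp add: sum.distrib R_def E_def layer_sum_def)
    finally show "\<bar>?h i\<bar> \<le> 1 * E i + R ?V i" .
  qed (use n in auto)
  moreover have "L ?h = 1 / (1 + z) * L (\<lambda>i. real (g i))"
    using mon_sym_norm_scale[OF L gv, of "1 / (1 + z)"] z by simp
  ultimately show "L (\<lambda>i. real (g i)) / (1 + z) - \<alpha> * L e1 \<le> L E" by simp
qed

lemma ex_sorting_permutation:
  fixes f :: "nat \<Rightarrow> nat"
  obtains p where "p permutes {..<n}" "\<And>i k. i \<le> k \<Longrightarrow> k < n \<Longrightarrow> f (p k) \<le> f (p i)"
proof -
  define xs where "xs = rev (sort_key f [0..<n])"
  have xs: "length xs = n" "set xs = {..<n}" "distinct xs" by (auto simp: xs_def)
  define p where "p i = (if i < n then xs ! i else i)" for i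
  have "bij_betw (\<lambda>i. xs ! i) {..<n} {..<n}"
    by (rule bij_betw_nth[OF xs(3)]) (simp_all only: xs)
  hence "bij_betw p {..<n} {..<n}"
    by (rule bij_betw_cong[THEN iffD1, rotated]) (simp add: p_def)
  hence "p permutes {..<n}" by (rule bij_imp_permutes) (simp add: p_def)
  moreover have "f (p k) \<le> f (p i)" if "i \<le> k" "k < n" for i k
  proof -
    have "sorted (rev (map f xs))" by (simp add: xs_def rev_map[symmetric])
    from sorted_rev_nth_mono[OF this that(1)] show ?thesis using that xs(1) by (simp add: p_def)
  qed
  ultimately show ?thesis by (rule that)
qed

text \<open>Only the sorted profile of \<^term>\<open>g\<close> matters for a symmetric norm.\<close>
lemma
  assumes z: "z > 0" and n: "n \<ge> 1" and L: "mon_sym_norm n L"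
    and supp: "\<And>i. i \<ge> n \<Longrightarrow> g i = 0" and gJ: "\<And>i. g i \<le> J"
    and eta: "\<And>j. j < J \<Longrightarrow> \<bar>eta j\<bar> \<le> B j"
    and \<alpha>: "(\<Sum>j<J. 4 * (B j)\<^sup>2 / width z j) \<le> \<alpha>"
  defines "E \<equiv> layer_sum z J n
     (\<lambda>j. real_of_int (layer_mass n (level z j) (level z (Suc j)) g) + eta j)"
  shows layer_sum_norm_le_unsorted: "L E \<le> (1 + z) * L (\<lambda>i. real (g i)) + \<alpha> * L e1"
    and layer_sum_norm_ge_unsorted: "L (\<lambda>i. real (g i)) / (1 + z) - \<alpha> * L e1 \<le> L E"
proof -
  obtain p where p: "p permutes {..<n}" and anti: "\<And>i k. i \<le> k \<Longrightarrow> k < n \<Longrightarrow> g (p k) \<le> g (p i)"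
    using ex_sorting_permutation[of n g] by blast
  have supp': "g (p i) = 0" if "i \<ge> n" for i
    using that p supp by (simp add: permutes_not_in)
  have "(\<lambda>i. real (g i)) \<in> vecs n" using supp by (simp add: vecs_def)
  hence Lg: "L (\<lambda>i. real (g (p i))) = L (\<lambda>i. real (g i))"
    using mon_sym_norm_permute[OF L _ p] by (simp add: o_def)
  \<comment> \<open>Layer masses ignore the order of the coordinates, so the sorted profile produces
    literally the same output \<open>E\<close>.\<close>
  have mass: "layer_mass n a b (\<lambda>i. g (p i)) = layer_mass n a b g" for a b
    unfolding layer_mass_def by (rule sum.reindex_bij_betw[OF permutes_imp_bij[OF p]])
  show "L E \<le> (1 + z) * L (\<lambda>i. real (g i)) + \<alpha> * L e1"
    using layer_sum_norm_le[OF z n L, of "\<lambda>i. g (p i)", OF anti supp' gJ eta \<alpha>]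
    unfolding E_def mass Lg .
  show "L (\<lambda>i. real (g i)) / (1 + z) - \<alpha> * L e1 \<le> L E"
    using layer_sum_norm_ge[OF z n L, of "\<lambda>i. g (p i)", OF anti supp' gJ eta \<alpha>]
    unfolding E_def mass Lg .
qed

section \<open>The mechanism\<close>

definition occ :: "(nat \<Rightarrow> nat option) \<Rightarrow> nat \<Rightarrow> nat \<Rightarrow> nat" where
  "occ s t i = card {r \<in> {1..t}. s r = Some i}"

lemma freq_eq_occ: "freq s t = (\<lambda>i. real (occ s t i))"
  by (simp add: freq_def occ_def fun_eq_iff)

lemma occ_zero [simp]: "occ s 0 i = 0"
  by (simp add: occ_def)

lemma occ_le: "occ s t i \<le> t"
proof -
  have "card {r \<in> {1..t}. s r = Some i} \<le> card {1..t}" by (intro card_mono) auto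
  thus ?thesis by (simp add: occ_def)
qed

lemma occ_mono: "t \<le> t' \<Longrightarrow> occ s t i \<le> occ s t' i"
  unfolding occ_def by (intro card_mono) auto

lemma occ_cong: "(\<And>r. r \<in> {1..t} \<Longrightarrow> u r = v r) \<Longrightarrow> occ u t = occ v t"
  unfolding occ_def by (intro ext arg_cong[where f = card]) auto

lemma occ_outside:
  assumes "valid_stream n T s" "i \<ge> n"
  shows "occ s t i = 0"
proof -
  have "s r \<noteq> Some i" for r using assms unfolding valid_stream_def by force
  thus ?thesis by (simp add: occ_def)
qed

lemma occ_delete:
  assumes "s r = Some i" "r \<ge> 1"
  shows "occ s t k = occ (s(r := None)) t k + of_bool (k = i \<and> r \<le> t)"
proof (cases "k = i \<and> r \<le> t")
  case True
  have "{x \<in> {1..t}. s x = Some k} = insert r {x \<in> {1..t}. (s(r := None)) x = Some k}"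
    using True assms by auto
  moreover have "r \<notin> {x \<in> {1..t}. (s(r := None)) x = Some k}" by simp
  ultimately show ?thesis using True by (simp add: occ_def)
next
  case False
  have "{x \<in> {1..t}. s x = Some k} = {x \<in> {1..t}. (s(r := None)) x = Some k}"
    using False assms by auto
  thus ?thesis using False unfolding occ_def by simp
qed

text \<open>A count clipped at \<open>c\<close> stops growing once it reaches \<open>c\<close>. In
  this form the change is a difference of two indicators that, as functions of time, switch on once
  and stay on.\<close>

lemma layer_mass_occ_delete:
  assumes "s r = Some i" "r \<ge> 1" "i < n"
  shows "layer_mass n a b (occ s t) - layer_mass n a b (occ (s(r := None)) t)
       = of_bool (r \<le> t \<and> a \<le> occ (s(r := None)) t i) - of_bool (r \<le> t \<and> b \<le> occ (s(r := None)) t i)"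
proof -
  let ?o = "occ (s(r := None)) t"
  have "layer_mass n a b (occ s t) - layer_mass n a b ?o
      = (\<Sum>k<n. if k = i then of_bool (r \<le> t \<and> a \<le> ?o i) - of_bool (r \<le> t \<and> b \<le> ?o i) else 0)"
    unfolding layer_mass_def sum_subtractf[symmetric]
    by (intro sum.cong refl) (auto simp: occ_delete[of s r i, OF assms(1,2)])
  thus ?thesis using assms by simp
qed

text \<open>The indicator never switches off, so the sum telescopes. The step \<open>m\<close> will
  be a dyadic block length.\<close>

lemma variation_indicator_le_1:
  fixes P :: "nat \<Rightarrow> bool"
  assumes "\<And>t t'. t \<le> t' \<Longrightarrow> P t \<Longrightarrow> P t'"
  shows "(\<Sum>q=1..Q. \<bar>of_bool (P (q * m)) - of_bool (P ((q - 1) * m))\<bar>) \<le> (1::int)"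
proof -
  have "(\<Sum>q=1..Q. \<bar>of_bool (P (q * m)) - of_bool (P ((q - 1) * m))\<bar>)
      = of_bool (P (Q * m)) - (of_bool (P 0) :: int)"
  proof (induction Q)
    case (Suc Q)
    have "P (Q * m) \<Longrightarrow> P (m + Q * m)" by (rule assms) simp_all
    thus ?case using Suc by auto
  qed simp
  also have "\<dots> \<le> 1" by simp
  finally show ?thesis .
qed

lemma layer_mass_variation_delete:
  fixes s :: "nat \<Rightarrow> nat option" and r a b :: nat
  assumes "valid_stream n T s"
  defines "D \<equiv> \<lambda>t. layer_mass n a b (occ s t) - layer_mass n a b (occ (s(r := None)) t)"
  shows "(\<Sum>q=1..Q. \<bar>D (q * m) - D ((q - 1) * m)\<bar>) \<le> 2"
proof (cases "s r")
  case None
  hence "s(r := None) = s" by auto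
  thus ?thesis by (simp add: D_def)
next
  case (Some i)
  hence r: "r \<ge> 1" "i < n" using assms by (auto simp: valid_stream_def)
  define P where "P c t \<longleftrightarrow> r \<le> t \<and> c \<le> occ (s(r := None)) t i" for c t
  have mono: "P c t \<Longrightarrow> P c t'" if "t \<le> t'" for c t t'
    using occ_mono[OF that, of "s(r := None)" i] that by (auto simp: P_def)
  have D: "D t = of_bool (P a t) - of_bool (P b t)" for t
    unfolding D_def P_def by (rule layer_mass_occ_delete; fact Some r)
  have "(\<Sum>q=1..Q. \<bar>D (q * m) - D ((q - 1) * m)\<bar>)
      \<le> (\<Sum>q=1..Q. \<bar>of_bool (P a (q * m)) - of_bool (P a ((q - 1) * m))\<bar>
                 + \<bar>of_bool (P b (q * m)) - of_bool (P b ((q - 1) * m))\<bar>)"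
    unfolding D by (intro sum_mono) linarith
  also have "\<dots> \<le> 1 + 1"
    unfolding sum.distrib
    using add_mono[OF variation_indicator_le_1[of "P a"] variation_indicator_le_1[of "P b"]] mono
    by blast
  finally show ?thesis by simp
qed

text \<open>Neighbours become equal after deleting the update at the time \<open>r\<close> where
  they differ; passing through this common stream costs variation 2 on either side, whatever the
  block length.\<close>

lemma layer_mass_variation_neighbors:
  fixes u v :: "nat \<Rightarrow> nat option" and a b :: nat
  assumes "event_neighbors n T u v"
  defines "D \<equiv> \<lambda>t. layer_mass n a b (occ u t) - layer_mass n a b (occ v t)"
  shows "(\<Sum>q=1..Q. \<bar>D (q * m) - D ((q - 1) * m)\<bar>) \<le> 4"
proof -
  have uv: "valid_stream n T u" "valid_stream n T v" and c: "card {t. u t \<noteq> v t} \<le> 1"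
    using assms by (auto simp: event_neighbors_def)
  \<comment> \<open>Finiteness has to be shown first, since \<open>card\<close> of an infinite set
    is 0.\<close>
  have "{t. u t \<noteq> v t} \<subseteq> {1..T}"
  proof
    fix t assume "t \<in> {t. u t \<noteq> v t}"
    hence "u t \<noteq> None \<or> v t \<noteq> None" by auto
    thus "t \<in> {1..T}" using uv unfolding valid_stream_def by blast
  qed
  hence "finite {t. u t \<noteq> v t}" by (rule finite_subset) simp
  with c obtain r where "{t. u t \<noteq> v t} \<subseteq> {r}"
    by (cases "{t. u t \<noteq> v t} = {}") (auto simp: card_le_Suc0_iff_eq)
  hence w: "u(r := None) = v(r := None)" by (auto simp: fun_eq_iff)
  define Du where "Du t = layer_mass n a b (occ u t) - layer_mass n a b (occ (u(r := None)) t)" for t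
  define Dv where "Dv t = layer_mass n a b (occ v t) - layer_mass n a b (occ (v(r := None)) t)" for t
  have D: "D t = Du t - Dv t" for t by (simp add: D_def Du_def Dv_def w)
  have "(\<Sum>q=1..Q. \<bar>D (q * m) - D ((q - 1) * m)\<bar>)
      \<le> (\<Sum>q=1..Q. \<bar>Du (q * m) - Du ((q - 1) * m)\<bar> + \<bar>Dv (q * m) - Dv ((q - 1) * m)\<bar>)"
    unfolding D by (intro sum_mono) linarith
  also have "\<dots> \<le> 2 + 2"
    unfolding sum.distrib Du_def Dv_def using uv by (intro add_mono layer_mass_variation_delete)
  finally show ?thesis by simp
qed

section \<open>Dyadic decomposition of prefixes\<close>

definition tree_sum :: "nat \<Rightarrow> (nat \<Rightarrow> nat \<Rightarrow> int) \<Rightarrow> nat \<Rightarrow> int" where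
  "tree_sum K x t = (\<Sum>l<K. if odd (t div 2 ^ l) then x l (t div 2 ^ l) else 0)"

lemma tree_sum_add: "tree_sum K (\<lambda>l q. x l q + y l q) t = tree_sum K x t + tree_sum K y t"
  unfolding tree_sum_def sum.distrib[symmetric] by (intro sum.cong) auto

text \<open>An odd quotient of \<open>t\<close> is nonzero and at most \<open>t\<close>. Hence times
  up to \<open>T\<close> read only finitely many nodes, those in \<open>noise_index\<close>.\<close>

lemma tree_sum_cong:
  assumes "\<And>l q. l < K \<Longrightarrow> 1 \<le> q \<Longrightarrow> q \<le> t \<Longrightarrow> x l q = y l q"
  shows "tree_sum K x t = tree_sum K y t"
  unfolding tree_sum_def by (intro sum.cong refl) (auto intro!: assms elim: oddE)

text \<open>The odd quotients \<open>t div 2 ^ l\<close> index the dyadic blocks \<open>((q - 1) * 2 ^ l, q * 2 ^ l]\<close>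
  into which the interval \<open>(0, t]\<close> is split by the binary expansion of \<open>t\<close>.\<close>
lemma tree_sum_block_increments:
  assumes "D 0 = 0" "t < 2 ^ K"
  shows "tree_sum K (\<lambda>l q. D (q * 2 ^ l) - D ((q - 1) * 2 ^ l)) t = D t"
proof -
  \<comment> \<open>Generalised to arbitrary depth for the induction: the levels below
    \<open>K\<close> collect the increment of \<open>D\<close> from \<open>t\<close> with its lowest
    \<open>K\<close> bits cleared up to \<open>t\<close>.\<close>
  have "tree_sum K (\<lambda>l q. D (q * 2 ^ l) - D ((q - 1) * 2 ^ l)) t = D t - D ((t div 2 ^ K) * 2 ^ K)" for K
  proof (induction K)
    case (Suc K)
    define q where "q = t div 2 ^ K"
    have "t div 2 ^ Suc K = q div 2" by (simp add: q_def div_mult2_eq mult.commute[of 2])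
    hence "(t div 2 ^ Suc K) * 2 ^ Suc K = (if odd q then (q - 1) * 2 ^ K else q * 2 ^ K)"
      by (auto elim!: oddE)
    thus ?case using Suc by (simp add: tree_sum_def q_def)
  qed (simp add: tree_sum_def)
  from this[of K] show ?thesis using assms by simp
qed

section \<open>The mechanism, its online property and its privacy\<close>

definition noise_index :: "nat \<Rightarrow> nat \<Rightarrow> (nat \<times> nat \<times> nat) set" where
  "noise_index T K = {..<T} \<times> {..<K} \<times> {1..T}"

definition tree_noise :: "nat \<Rightarrow> nat \<Rightarrow> (nat \<Rightarrow> real) \<Rightarrow> (nat \<times> nat \<times> nat \<Rightarrow> int) pmf" where
  "tree_noise T K e = Pi_pmf (noise_index T K) 0 (\<lambda>(j, l, q). discrete_laplace (e j))"

definition noisy_mass ::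
  "real \<Rightarrow> nat \<Rightarrow> nat \<Rightarrow> (nat \<Rightarrow> nat option) \<Rightarrow> (nat \<times> nat \<times> nat \<Rightarrow> int) \<Rightarrow> nat \<Rightarrow> nat \<Rightarrow> int" where
  "noisy_mass z n K s x t j =
     layer_mass n (level z j) (level z (Suc j)) (occ s t) + tree_sum K (\<lambda>l q. x (j, l, q)) t"

definition release ::
  "real \<Rightarrow> nat \<Rightarrow> nat \<Rightarrow> nat \<Rightarrow> (nat \<Rightarrow> nat option) \<Rightarrow> (nat \<times> nat \<times> nat \<Rightarrow> int) \<Rightarrow> nat \<times> nat \<Rightarrow> real" where
  "release z n T K s x =
     (\<lambda>(t, i) \<in> {1..T} \<times> {..<n}. layer_sum z T n (\<lambda>j. real_of_int (noisy_mass z n K s x t j)) i)"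

definition mechanism ::
  "real \<Rightarrow> nat \<Rightarrow> nat \<Rightarrow> nat \<Rightarrow> (nat \<Rightarrow> real) \<Rightarrow> (nat \<Rightarrow> nat option) \<Rightarrow> (nat \<times> nat \<Rightarrow> real) measure" where
  "mechanism z n T K e s = distr (measure_pmf (tree_noise T K e)) (out_space n T) (release z n T K s)"

lemma finite_noise_index [simp]: "finite (noise_index T K)"
  by (simp add: noise_index_def)

lemma release_in_space: "release z n T K s x \<in> space (out_space n T)"
  by (auto simp: release_def out_space_def space_PiM)

lemma measurable_release [measurable]:
  "release z n T K s \<in> measurable (measure_pmf p) (out_space n T)"
  by (simp add: release_in_space)

lemma measure_mechanism:
  assumes "S \<in> sets (out_space n T)"
  shows "measure (mechanism z n T K e s) S = measure_pmf.prob (tree_noise T K e) {x. release z n T K s x \<in> S}"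
  unfolding mechanism_def using assms by (subst measure_distr) (auto simp: vimage_def release_in_space)

lemma out_vec_release:
  assumes "t \<in> {1..T}"
  shows "out_vec n (release z n T K s x) t = layer_sum z T n (\<lambda>j. real_of_int (noisy_mass z n K s x t j))"
  using assms by (auto simp: out_vec_def release_def layer_sum_def fun_eq_iff)

lemma continual_mechanism_mechanism: "continual_mechanism n T (mechanism z n T K e)"
  unfolding continual_mechanism_def
proof (intro conjI allI impI)
  fix s
  show "prob_space (mechanism z n T K e s)"
    unfolding mechanism_def by (intro prob_space.prob_space_distr measure_pmf.prob_space_axioms) measurable
  show "sets (mechanism z n T K e s) = sets (out_space n T)"
    "space (mechanism z n T K e s) = space (out_space n T)"
    by (simp_all add: mechanism_def)
next
  fix u v :: "nat \<Rightarrow> nat option" and t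
  assume uv: "\<forall>r\<in>{1..t}. u r = v r"
  let ?I = "{1..min t T} \<times> {..<n}"
  let ?P = "PiM ?I (\<lambda>_. borel) :: (nat \<times> nat \<Rightarrow> real) measure"
  have r [measurable]: "(\<lambda>E. restrict E ?I) \<in> measurable (out_space n T) ?P"
    unfolding out_space_def by (rule measurable_restrict_subset) auto
  \<comment> \<open>With the noise held fixed, the first outputs coincide exactly, so their laws
    agree.\<close>
  have eq: "restrict (release z n T K u x) ?I = restrict (release z n T K v x) ?I" for x
  proof (rule restrict_ext)
    fix y assume y: "y \<in> ?I"
    obtain t' i where "y = (t', i)" by (cases y)
    moreover have "occ u t' = occ v t'" if "t' \<le> t"
      using uv that by (intro occ_cong) auto
    ultimately show "release z n T K u x y = release z n T K v x y"
      using y by (simp add: release_def noisy_mass_def)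
  qed
  show "distr (mechanism z n T K e u) ?P (\<lambda>E. restrict E ?I)
      = distr (mechanism z n T K e v) ?P (\<lambda>E. restrict E ?I)"
    unfolding mechanism_def distr_distr[OF r measurable_release] by (simp only: o_def eq)
qed

text \<open>Replacing \<^term>\<open>u\<close> by a neighbour \<^term>\<open>v\<close> has the same effect on the output as a
  deterministic shift of the noise, of weighted \<open>\<ell>\<^sub>1\<close>-norm at most \<^term>\<open>eps\<close>.\<close>
lemma event_DP_mechanism:
  assumes e: "\<And>j. j < T \<Longrightarrow> e j > 0" and K: "T < 2 ^ K"
    and budget: "(\<Sum>j<T. 4 * real K * e j) \<le> eps" and "\<delta> \<ge> 0"
  shows "event_DP eps \<delta> n T (mechanism z n T K e)"
  unfolding event_DP_def
proof (intro allI impI ballI)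
  fix u v S assume nb: "event_neighbors n T u v" and S: "S \<in> sets (out_space n T)"
  define D where "D j t = layer_mass n (level z j) (level z (Suc j)) (occ u t)
     - layer_mass n (level z j) (level z (Suc j)) (occ v t)" for j t
  \<comment> \<open>Each tree node is shifted by the increment of the mass difference
    \<open>D j\<close> over its block, so the noise of the prefix up to \<open>t\<close> moves by
    exactly \<open>D j t\<close>.\<close>
  define d :: "nat \<times> nat \<times> nat \<Rightarrow> int" where
    "d i = (if i \<in> noise_index T K then (case i of (j, l, q) \<Rightarrow> D j (q * 2 ^ l) - D j ((q - 1) * 2 ^ l)) else 0)"
    for i
  have shift: "noisy_mass z n K u x t j = noisy_mass z n K v (\<lambda>i. x i + d i) t j"
    if "t \<in> {1..T}" "j < T" for x t j
  proof -
    have "tree_sum K (\<lambda>l q. d (j, l, q)) t = tree_sum K (\<lambda>l q. D j (q * 2 ^ l) - D j ((q - 1) * 2 ^ l)) t"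
      using that by (intro tree_sum_cong) (auto simp: d_def noise_index_def)
    also have "\<dots> = D j t"
      using that K by (intro tree_sum_block_increments) (auto simp: D_def layer_mass_def)
    finally show ?thesis by (simp add: noisy_mass_def tree_sum_add D_def)
  qed
  have rel: "release z n T K u x = release z n T K v (\<lambda>i. x i + d i)" for x
    unfolding release_def layer_sum_def
    by (intro restrict_ext) (auto intro!: sum.cong simp: shift)
  have norm: "(\<Sum>i\<in>noise_index T K. (case i of (j, l, q) \<Rightarrow> e j) * \<bar>real_of_int (d i)\<bar>) \<le> eps"
  proof -
    have "(\<Sum>i\<in>noise_index T K. (case i of (j, l, q) \<Rightarrow> e j) * \<bar>real_of_int (d i)\<bar>)
        = (\<Sum>j<T. \<Sum>l<K. \<Sum>q=1..T. e j * \<bar>real_of_int (d (j, l, q))\<bar>)"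
      unfolding noise_index_def sum.cartesian_product by (intro sum.cong) auto
    \<comment> \<open>On each of the \<open>K\<close> tree levels the block increments have total
      variation at most 4, so layer \<open>j\<close> costs \<open>4 * K * e j\<close> in
      all.\<close>
    also have "\<dots> \<le> (\<Sum>j<T. \<Sum>l<K. 4 * e j)"
    proof (intro sum_mono)
      fix j l assume jl: "j \<in> {..<T}" "l \<in> {..<K}"
      have "(\<Sum>q=1..T. \<bar>d (j, l, q)\<bar>) = (\<Sum>q=1..T. \<bar>D j (q * 2 ^ l) - D j ((q - 1) * 2 ^ l)\<bar>)"
        using jl by (intro sum.cong) (auto simp: d_def noise_index_def)
      also have "\<dots> \<le> 4"
        unfolding D_def by (rule layer_mass_variation_neighbors[OF nb])
      finally have "real_of_int (\<Sum>q=1..T. \<bar>d (j, l, q)\<bar>) \<le> real_of_int 4"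
        by (simp only: of_int_le_iff)
      from mult_left_mono[OF this, of "e j"] e[of j] jl
      show "(\<Sum>q=1..T. e j * \<bar>real_of_int (d (j, l, q))\<bar>) \<le> 4 * e j"
        by (simp add: sum_distrib_left mult.commute)
    qed
    also have "\<dots> \<le> eps" using budget by (simp add: algebra_simps)
    finally show ?thesis .
  qed
  have prod: "(\<lambda>i. discrete_laplace (case i of (j, l, q) \<Rightarrow> e j)) = (\<lambda>(j, l, q). discrete_laplace (e j))"
    by auto
  have "measure_pmf.prob (tree_noise T K e) {x. release z n T K u x \<in> S}
     \<le> exp eps * measure_pmf.prob (tree_noise T K e) {x. release z n T K v x \<in> S}"
    using discrete_laplace_mechanism[OF finite_noise_index _ _ norm, of "{x. release z n T K v x \<in> S}"]
    unfolding tree_noise_def prod rel by (auto simp: d_def noise_index_def e)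
  thus "measure (mechanism z n T K e u) S \<le> exp eps * measure (mechanism z n T K e v) S + \<delta>"
    using S \<open>\<delta> \<ge> 0\<close> by (simp add: measure_mechanism)
qed

section \<open>Accuracy at a fixed time\<close>

lemma tree_noise_deviation:
  assumes e: "\<And>j. j < T \<Longrightarrow> e j > 0" and j: "j < T" and t: "t \<in> {1..T}" and b: "b > 0"
  shows "measure_pmf.prob (tree_noise T K e)
      {x. b \<le> \<bar>real_of_int (tree_sum K (\<lambda>l q. x (j, l, q)) t)\<bar>} \<le> 16 * real K / (e j)\<^sup>2 / b\<^sup>2"
proof -
  \<comment> \<open>\<open>H\<close> collects the tree nodes read at time \<open>t\<close>: at most
    one per tree level, so the noise of a prefix is a sum of at most \<open>K\<close> independent
    variables.\<close>
  define H where "H = (\<lambda>l. (j, l, t div 2 ^ l)) ` {l. l < K \<and> odd (t div 2 ^ l)}"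
  have H: "H \<subseteq> noise_index T K"
  proof -
    have "t div 2 ^ l \<in> {1..T}" if "odd (t div 2 ^ l)" for l
      using that t div_le_dividend[of t "2 ^ l"] by (auto simp del: div_le_dividend elim!: oddE)
    thus ?thesis using j by (auto simp: H_def noise_index_def)
  qed
  have inj: "inj_on (\<lambda>l. (j, l, t div 2 ^ l)) A" for A by (auto simp: inj_on_def)
  have sum: "real_of_int (tree_sum K (\<lambda>l q. x (j, l, q)) t) = (\<Sum>i\<in>H. real_of_int (x i))" for x
  proof -
    have "tree_sum K (\<lambda>l q. x (j, l, q)) t = (\<Sum>l\<in>{l. l < K \<and> odd (t div 2 ^ l)}. x (j, l, t div 2 ^ l))"
      unfolding tree_sum_def by (simp add: sum.If_cases Int_def)
    also have "\<dots> = (\<Sum>i\<in>H. x i)"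
      unfolding H_def by (subst sum.reindex[OF inj]) simp
    finally show ?thesis by simp
  qed
  let ?e = "\<lambda>i :: nat \<times> nat \<times> nat. case i of (j, l, q) \<Rightarrow> e j"
  have N: "tree_noise T K e = Pi_pmf (noise_index T K) 0 (\<lambda>i. discrete_laplace (?e i))"
    unfolding tree_noise_def by (rule arg_cong[where f = "Pi_pmf _ _"]) auto
  have e': "?e i > 0" if "i \<in> noise_index T K" for i
    using that e by (auto simp: noise_index_def)
  have m: "integrable (measure_pmf (tree_noise T K e)) (\<lambda>x. (\<Sum>i\<in>H. real_of_int (x i))\<^sup>2)"
    "measure_pmf.expectation (tree_noise T K e) (\<lambda>x. (\<Sum>i\<in>H. real_of_int (x i))\<^sup>2)
       \<le> (\<Sum>i\<in>H. 16 / (?e i)\<^sup>2)"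
    unfolding N
    by (rule integrable_square_sum_discrete_laplace[OF finite_noise_index e' H]
        second_moment_sum_discrete_laplace[OF finite_noise_index e' H]; assumption)+
  have "measure_pmf.prob (tree_noise T K e) {x. b \<le> \<bar>\<Sum>i\<in>H. real_of_int (x i)\<bar>}
     \<le> measure_pmf.expectation (tree_noise T K e) (\<lambda>x. (\<Sum>i\<in>H. real_of_int (x i))\<^sup>2) / b\<^sup>2"
    by (rule prob_abs_ge_second_moment[OF m(1) b])
  also have "\<dots> \<le> (\<Sum>i\<in>H. 16 / (?e i)\<^sup>2) / b\<^sup>2"
    by (intro divide_right_mono m(2)) simp
  also have "(\<Sum>i\<in>H. 16 / (?e i)\<^sup>2) = (\<Sum>i\<in>H. 16 / (e j)\<^sup>2)"
    by (intro sum.cong refl) (auto simp: H_def)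
  also have "\<dots> = real (card H) * (16 / (e j)\<^sup>2)"
    by (rule sum_constant)
  also have "\<dots> \<le> real K * (16 / (e j)\<^sup>2)"
  proof (intro mult_right_mono)
    have "card H \<le> card {l. l < K \<and> odd (t div 2 ^ l)}" unfolding H_def by (rule card_image_le) simp
    also have "\<dots> \<le> card {..<K}" by (intro card_mono) auto
    finally show "real (card H) \<le> real K" by simp
  qed simp
  finally show ?thesis by (simp add: sum divide_right_mono mult.commute)
qed

text \<open>Provides the measurable witness for accuracy: the event there quantifies over all norms
  at once and is not evidently measurable, but discrete noise leaves a countable set of good outputs
  inside it.\<close>

lemma countable_sets_out_space:
  assumes "countable A" "A \<subseteq> space (out_space n T)"
  shows "A \<in> sets (out_space n T)"
proof (rule sets.countable[OF _ assms(1)])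
  fix x assume "x \<in> A"
  hence "x \<in> extensional ({1..T} \<times> {..<n})"
    using assms(2) by (auto simp: out_space_def space_PiM PiE_def)
  hence "{x} = PiE ({1..T} \<times> {..<n}) (\<lambda>i. {x i})" by (simp add: PiE_singleton)
  also have "\<dots> \<in> sets (out_space n T)"
    unfolding out_space_def by (intro sets_PiM_I_finite) auto
  finally show "{x} \<in> sets (out_space n T)" .
qed

text \<open>The failure event concerns only the noise, one deviation per layer joined by a union
  bound. It does not mention \<open>L\<close>, so a single event serves all norms
  simultaneously.\<close>

lemma mechanism_accuracy:
  assumes z: "z > 0" and n: "n \<ge> 1" and s: "valid_stream n T s" and t: "t \<in> {1..T}"
    and e: "\<And>j. j < T \<Longrightarrow> e j > 0" and B: "\<And>j. j < T \<Longrightarrow> B j > 0"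
    and fail: "(\<Sum>j<T. 16 * real K / (e j)\<^sup>2 / (B j)\<^sup>2) \<le> 1 / 3"
    and \<alpha>: "(\<Sum>j<T. 4 * (B j)\<^sup>2 / width z j) \<le> \<alpha>"
  obtains A where "A \<in> sets (out_space n T)" "measure (mechanism z n T K e s) A \<ge> 2/3"
    "A \<subseteq> {E \<in> space (out_space n T). \<forall>L. mon_sym_norm n L \<longrightarrow>
              L (freq s t) / (1 + z) - \<alpha> * L e1 \<le> L (out_vec n E t) \<and>
              L (out_vec n E t) \<le> (1 + z) * L (freq s t) + \<alpha> * L e1}"
proof
  let ?N = "tree_noise T K e"
  define eta where "eta x j = real_of_int (tree_sum K (\<lambda>l q. x (j, l, q)) t)"
    for x :: "nat \<times> nat \<times> nat \<Rightarrow> int" and j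
  define G where "G = {x. \<forall>j<T. \<bar>eta x j\<bar> < B j}"
  define A where "A = release z n T K s ` (G \<inter> set_pmf ?N)"
  have A_space: "A \<subseteq> space (out_space n T)" by (auto simp: A_def release_in_space)
  have "countable A" unfolding A_def by (intro countable_image countable_Int2 countable_set_pmf)
  thus A_sets: "A \<in> sets (out_space n T)" using A_space by (rule countable_sets_out_space)
  have "measure_pmf.prob ?N (- G) \<le> measure_pmf.prob ?N (\<Union>j<T. {x. B j \<le> \<bar>eta x j\<bar>})"
    by (intro measure_pmf.finite_measure_mono) (auto simp: G_def not_less)
  also have "\<dots> \<le> (\<Sum>j<T. measure_pmf.prob ?N {x. B j \<le> \<bar>eta x j\<bar>})"
    by (intro measure_UNION_le) auto
  also have "\<dots> \<le> (\<Sum>j<T. 16 * real K / (e j)\<^sup>2 / (B j)\<^sup>2)"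
    unfolding eta_def using tree_noise_deviation[OF e _ t B] by (intro sum_mono) auto
  also have "\<dots> \<le> 1 / 3" by (rule fail)
  finally have "measure_pmf.prob ?N G \<ge> 2/3"
    using measure_pmf.prob_compl[of G ?N] by (simp add: Compl_eq_Diff_UNIV)
  also have "measure_pmf.prob ?N G = measure_pmf.prob ?N (G \<inter> set_pmf ?N)"
    by (simp add: measure_Int_set_pmf)
  also have "\<dots> \<le> measure_pmf.prob ?N {x. release z n T K s x \<in> A}"
    by (intro measure_pmf.finite_measure_mono) (auto simp: A_def)
  also have "\<dots> = measure (mechanism z n T K e s) A"
    by (rule measure_mechanism[OF A_sets, symmetric])
  finally show "measure (mechanism z n T K e s) A \<ge> 2/3" .
  have "L (freq s t) / (1 + z) - \<alpha> * L e1 \<le> L (out_vec n (release z n T K s x) t) \<and>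
        L (out_vec n (release z n T K s x) t) \<le> (1 + z) * L (freq s t) + \<alpha> * L e1"
    if L: "mon_sym_norm n L" and x: "x \<in> G" for L x
  proof -
    have supp: "occ s t i = 0" if "i \<ge> n" for i by (rule occ_outside[OF s that])
    have le: "occ s t i \<le> T" for i using occ_le[of s t i] t by simp
    have eta: "\<bar>eta x j\<bar> \<le> B j" if "j < T" for j using x that by (auto simp: G_def intro: less_imp_le)
    have out: "out_vec n (release z n T K s x) t = layer_sum z T n
        (\<lambda>j. real_of_int (layer_mass n (level z j) (level z (Suc j)) (occ s t)) + eta x j)"
      unfolding out_vec_release[OF t] by (simp add: noisy_mass_def eta_def)
    show ?thesis
      unfolding out freq_eq_occ
      using layer_sum_norm_le_unsorted[where g = "occ s t" and eta = "eta x", OF z n L supp le eta \<alpha>]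
        layer_sum_norm_ge_unsorted[where g = "occ s t" and eta = "eta x", OF z n L supp le eta \<alpha>]
      by blast
  qed
  thus "A \<subseteq> {E \<in> space (out_space n T). \<forall>L. mon_sym_norm n L \<longrightarrow>
              L (freq s t) / (1 + z) - \<alpha> * L e1 \<le> L (out_vec n E t) \<and>
              L (out_vec n E t) \<le> (1 + z) * L (freq s t) + \<alpha> * L e1}"
    using A_space by (auto simp: A_def)
qed

section \<open>Choice of the parameters\<close>

text \<open>Slow enough that \<open>(1 + z) * decay z ^ 4 \<ge> 1\<close>. Of these four powers the
  squared inverse budget uses two and the failure probability one; the last makes the layer errors
  summable.\<close>

definition decay :: "real \<Rightarrow> real" where
  "decay z = 1 - z / 8"

text \<open>Here 32 is 4 * 8: neighbours cost \<open>4 * K\<close> per unit of budget, and the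
  powers of \<open>decay z\<close> sum to at most \<open>8 / z\<close>.\<close>

definition level_budget :: "real \<Rightarrow> real \<Rightarrow> nat \<Rightarrow> nat \<Rightarrow> real" where
  "level_budget eps z K j = eps * z * decay z ^ j / (32 * real K)"

text \<open>Chebyshev's inequality at this radius fails at level \<^term>\<open>j\<close> with probability at most
  \<^term>\<open>z * decay z ^ j / 24\<close>, which sums to at most 1/3 over the levels.\<close>
definition level_radius :: "real \<Rightarrow> real \<Rightarrow> nat \<Rightarrow> nat \<Rightarrow> real" where
  "level_radius eps z K j =
     sqrt (16 * real K / (level_budget eps z K j)\<^sup>2 * (24 / (z * decay z ^ j)))"

context
  fixes eps z :: real and K :: nat
  assumes eps: "eps > 0" and z: "0 < z" "z \<le> 1 / 2" and K: "K \<ge> 1"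
begin

lemma decay_bounds: "0 < decay z" "decay z < 1"
  using z by (auto simp: decay_def)

lemma sum_decay_le: "(\<Sum>j<J. decay z ^ j) \<le> 8 / z"
proof -
  have "(\<Sum>j<J. decay z ^ j) = (1 - decay z ^ J) / (1 - decay z)"
    using decay_bounds by (simp add: sum_gp_strict)
  also have "\<dots> \<le> 1 / (1 - decay z)"
    using decay_bounds by (intro divide_right_mono) auto
  also have "\<dots> = 8 / z" by (simp add: decay_def)
  finally show ?thesis .
qed

text \<open>Bernoulli gives \<open>decay z ^ 4 \<ge> 1 - z / 2\<close>, and
  \<open>(1 + z) * (1 - z / 2) \<ge> 1\<close> because \<open>z \<le> 1\<close>.\<close>

lemma decay_growth: "1 \<le> (1 + z) * decay z ^ 4"
proof -
  have "1 + real 4 * (- z / 8) \<le> (1 + (- z / 8)) ^ 4"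
    using z by (intro Bernoulli_inequality) auto
  hence "1 - z / 2 \<le> decay z ^ 4" by (simp add: decay_def)
  hence "(1 + z) * (1 - z / 2) \<le> (1 + z) * decay z ^ 4"
    using z by (intro mult_left_mono) auto
  moreover have "1 \<le> (1 + z) * (1 - z / 2)"
  proof -
    have "z * z \<le> z * 1" using z by (intro mult_left_mono) auto
    thus ?thesis by (simp add: field_simps)
  qed
  ultimately show ?thesis by simp
qed

text \<open>By \<open>width_ge_power\<close> the widths grow at least like
  \<open>z * (1 + z) ^ j\<close>, which compensates four powers of the decay; 3/2 bounds
  \<open>1 + z\<close>.\<close>

lemma width_decay: "z \<le> 3 / 2 * (real (width z j) * decay z ^ (4 * j))"
proof -
  have d: "decay z ^ (4 * j) \<ge> 0" using decay_bounds by simp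
  have "z * 1 \<le> z * ((1 + z) * decay z ^ 4) ^ j"
    using decay_growth z by (intro mult_left_mono one_le_power) auto
  also have "\<dots> = z * (1 + z) ^ j * decay z ^ (4 * j)"
    by (simp add: power_mult_distrib power_mult)
  also have "\<dots> \<le> (1 + z) * real (width z j) * decay z ^ (4 * j)"
    using width_ge_power[OF z(1), of j] d by (intro mult_right_mono)
  also have "\<dots> \<le> 3 / 2 * real (width z j) * decay z ^ (4 * j)"
    using z d by (intro mult_right_mono) auto
  finally show ?thesis by (simp add: mult.assoc)
qed

lemma level_budget_pos: "level_budget eps z K j > 0"
  using eps z K decay_bounds by (simp add: level_budget_def)

lemma level_radius_square:
  "(level_radius eps z K j)\<^sup>2 = 16 * real K / (level_budget eps z K j)\<^sup>2 * (24 / (z * decay z ^ j))"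
  using z decay_bounds unfolding level_radius_def by (subst real_sqrt_pow2) auto

lemma level_radius_pos: "level_radius eps z K j > 0"
  using z K decay_bounds level_budget_pos[of j] unfolding level_radius_def by simp

lemma sum_level_budget_le: "(\<Sum>j<J. 4 * real K * level_budget eps z K j) \<le> eps"
proof -
  have "(\<Sum>j<J. 4 * real K * level_budget eps z K j) = eps * z / 8 * (\<Sum>j<J. decay z ^ j)"
    unfolding sum_distrib_left using K by (intro sum.cong) (auto simp: level_budget_def)
  also have "\<dots> \<le> eps * z / 8 * (8 / z)"
    using eps z by (intro mult_left_mono sum_decay_le) auto
  also have "\<dots> = eps" using z by simp
  finally show ?thesis .
qed

lemma sum_failure_le:
  "(\<Sum>j<J. 16 * real K / (level_budget eps z K j)\<^sup>2 / (level_radius eps z K j)\<^sup>2) \<le> 1 / 3"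
proof -
  have "(\<Sum>j<J. 16 * real K / (level_budget eps z K j)\<^sup>2 / (level_radius eps z K j)\<^sup>2)
      = z / 24 * (\<Sum>j<J. decay z ^ j)"
    unfolding sum_distrib_left level_radius_square
    using K z decay_bounds level_budget_pos by (intro sum.cong) (auto simp: less_imp_neq[symmetric])
  also have "\<dots> \<le> z / 24 * (8 / z)"
    using z by (intro mult_left_mono sum_decay_le) auto
  also have "\<dots> = 1 / 3" using z by simp
  finally show ?thesis .
qed

text \<open>Of the five factors \<open>1 / z\<close>, two come from the squared budget, one from the
  failure probability, one from the lower bound on the widths and one from the geometric
  sum.\<close>

lemma sum_level_error_le:
  "(\<Sum>j<J. 4 * (level_radius eps z K j)\<^sup>2 / width z j) \<le> 18874368 * real K ^ 3 / (eps\<^sup>2 * z ^ 5)"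
proof -
  have "4 * (level_radius eps z K j)\<^sup>2 / width z j
      \<le> 2359296 * real K ^ 3 / (eps\<^sup>2 * z ^ 4) * decay z ^ j" for j
  proof -
    define d w where "d = decay z ^ j" and "w = real (width z j)"
    have pos: "d > 0" "w > 0" using decay_bounds by (simp_all add: d_def w_def)
    have zw: "z \<le> 3 / 2 * (w * d ^ 4)"
      using width_decay[of j] by (simp add: d_def w_def power_mult[symmetric] mult.commute)
    \<comment> \<open>The constant is 4 * 16 * 24 * 32^2. One factor \<open>z\<close> is split off
      to be paired with the width.\<close>
    have "4 * (level_radius eps z K j)\<^sup>2 / width z j
        = 1572864 * real K ^ 3 / (eps\<^sup>2 * z ^ 4) * (z / (w * d ^ 3))"
      unfolding level_radius_square level_budget_def d_def[symmetric] w_def[symmetric]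
      using pos z eps K by (simp add: field_simps power2_eq_square eval_nat_numeral)
    also have "\<dots> \<le> 1572864 * real K ^ 3 / (eps\<^sup>2 * z ^ 4) * (3 / 2 * d)"
    proof (intro mult_left_mono)
      have "z \<le> 3 / 2 * d * (w * d ^ 3)" using zw by (simp add: eval_nat_numeral mult_ac)
      thus "z / (w * d ^ 3) \<le> 3 / 2 * d" using pos by (simp add: pos_divide_le_eq)
    qed (use z in auto)
    also have "\<dots> = 2359296 * real K ^ 3 / (eps\<^sup>2 * z ^ 4) * d" by simp
    finally show ?thesis by (simp only: d_def)
  qed
  hence "(\<Sum>j<J. 4 * (level_radius eps z K j)\<^sup>2 / width z j)
      \<le> (\<Sum>j<J. 2359296 * real K ^ 3 / (eps\<^sup>2 * z ^ 4) * decay z ^ j)"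
    by (intro sum_mono)
  also have "\<dots> \<le> 2359296 * real K ^ 3 / (eps\<^sup>2 * z ^ 4) * (8 / z)"
    unfolding sum_distrib_left[symmetric] using z by (intro mult_left_mono sum_decay_le) auto
  also have "\<dots> = 18874368 * real K ^ 3 / (eps\<^sup>2 * z ^ 5)"
    by (simp add: eval_nat_numeral)
  finally show ?thesis .
qed

end

section \<open>Tree depth and final constants\<close>

lemma ex_tree_depth:
  assumes "T \<ge> 1"
  obtains K :: nat where "K \<ge> 1" "T < 2 ^ K" "real K \<le> 3 * lg (real T)"
proof
  \<comment> \<open>The factor 2 offsets \<open>ln 2 < 1\<close>: with \<open>ln 2 \<ge> 2/3\<close>
    it gives \<open>K * ln 2 \<ge> 4/3 * lg T > ln T\<close>. Rounding up adds at most
    \<open>1 \<le> lg T\<close>.\<close>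
  define K where "K = nat \<lceil>2 * lg (real T)\<rceil>"
  have lg: "lg (real T) \<ge> 1" "ln (real T) \<le> lg (real T)" by (auto simp: lg_def)
  have K: "2 * lg (real T) \<le> real K" "real K \<le> 2 * lg (real T) + 1"
    using lg by (simp_all add: K_def)
  show "K \<ge> 1" "real K \<le> 3 * lg (real T)" using K lg by linarith+
  have "ln 2 \<ge> (2/3 :: real)" by (rule ln2_ge_two_thirds)
  hence "ln (real T) < real K * ln 2"
    using mult_mono[OF K(1), of "2/3" "ln 2"] lg by simp
  also have "\<dots> = ln (2 ^ K)" by (simp add: ln_realpow)
  finally have "real T < 2 ^ K" using assms by (subst (asm) ln_less_cancel_iff) auto
  thus "T < 2 ^ K" by (metis of_nat_less_iff of_nat_numeral of_nat_power)
qed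

lemma lg_power3_le:
  assumes "n \<ge> 1" "T \<ge> 1"
  shows "lg (real T) ^ 3 \<le> lg (real T) powr 2.5 * lg (real n * real T) powr 0.5"
proof -
  have lg: "lg (real T) \<ge> 1" by (simp add: lg_def)
  have "ln (real T) \<le> ln (real n * real T)" using assms by (intro ln_mono) auto
  hence "lg (real T) \<le> lg (real n * real T)" by (simp add: lg_def)
  have "lg (real T) ^ 3 = lg (real T) powr (2.5 + 0.5)"
    using lg by (simp add: powr_numeral)
  also have "\<dots> = lg (real T) powr 2.5 * lg (real T) powr 0.5" by (rule powr_add)
  also have "\<dots> \<le> lg (real T) powr 2.5 * lg (real n * real T) powr 0.5"
    using lg \<open>lg (real T) \<le> _\<close> by (intro mult_left_mono powr_mono2) auto
  finally show ?thesis .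
qed

theorem mainTheorem19:
  shows "\<exists>C c::real. C > 0 \<and> c \<ge> 0 \<and>
    (\<forall>(\<epsilon>::real) (\<delta>::real) (\<zeta>::real) (n::nat) (T::nat).
       \<epsilon> > 0 \<longrightarrow> 0 < \<delta> \<longrightarrow> \<delta> < 1 \<longrightarrow> 0 < \<zeta> \<longrightarrow> \<zeta> \<le> 1/2 \<longrightarrow> n \<ge> 1 \<longrightarrow> T \<ge> 1 \<longrightarrow>
       (let \<alpha> = C * (lg (real T) powr 2.5 * lg (real n * real T) powr 0.5 * lg (1/\<delta>)
                    / (\<epsilon>^2 * \<zeta>^5))
                  * lg (lg (real n * real T) + lg (1/\<delta>) + 1/\<epsilon> + 1/\<zeta>) powr c
        in \<exists>M. continual_mechanism n T M \<and> event_DP \<epsilon> \<delta> n T M \<and>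
           (\<forall>s t. valid_stream n T s \<longrightarrow> t \<in> {1..T} \<longrightarrow>
              (\<exists>A\<in>sets (out_space n T).
                 A \<subseteq> {E \<in> space (out_space n T). \<forall>L. mon_sym_norm n L \<longrightarrow>
                        L (freq s t) / (1 + \<zeta>) - \<alpha> * L e1 \<le> L (out_vec n E t) \<and>
                        L (out_vec n E t) \<le> (1 + \<zeta>) * L (freq s t) + \<alpha> * L e1}
                 \<and> measure (M s) A \<ge> 2/3))))"
proof (rule exI[of _ 509607936], rule exI[of _ 0], intro conjI allI impI)
  fix \<epsilon> \<delta> \<zeta> :: real and n T :: nat
  assume \<epsilon>: "\<epsilon> > 0" and \<delta>: "0 < \<delta>" "\<delta> < 1" and \<zeta>: "0 < \<zeta>" "\<zeta> \<le> 1/2" and n: "n \<ge> 1" and T: "T \<ge> 1"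
  let ?P = "lg (real T) powr 2.5 * lg (real n * real T) powr 0.5"
  define \<alpha> where "\<alpha> = 509607936 * (?P * lg (1/\<delta>) / (\<epsilon>^2 * \<zeta>^5))
                  * lg (lg (real n * real T) + lg (1/\<delta>) + 1/\<epsilon> + 1/\<zeta>) powr 0"
  obtain K where K: "K \<ge> 1" "T < 2 ^ K" "real K \<le> 3 * lg (real T)"
    using ex_tree_depth[OF T] by blast
  \<comment> \<open>The constant 509607936 is 27 * 18874368, where 27 is the cube of the 3 in
    \<open>K \<le> 3 * lg T\<close>. The factor \<open>lg (1/\<delta>)\<close> enters through being
    at least 1, and the exponent 0 leaves no hidden polylogarithmic factor.\<close>
  have error: "(\<Sum>j<T. 4 * (level_radius \<epsilon> \<zeta> K j)\<^sup>2 / width \<zeta> j) \<le> \<alpha>"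
  proof -
    have "real K ^ 3 \<le> (3 * lg (real T)) ^ 3" using K by (intro power_mono) auto
    also have "\<dots> \<le> 27 * ?P * 1" using lg_power3_le[OF n T] by (simp add: power_mult_distrib)
    also have "27 * ?P * 1 \<le> 27 * ?P * lg (1/\<delta>)"
      by (intro mult_left_mono mult_nonneg_nonneg) (auto simp: lg_def)
    finally have "18874368 * real K ^ 3 / (\<epsilon>\<^sup>2 * \<zeta> ^ 5) \<le> 18874368 * (27 * ?P * lg (1/\<delta>)) / (\<epsilon>\<^sup>2 * \<zeta> ^ 5)"
      using \<zeta> by (intro divide_right_mono mult_left_mono) auto
    also have "\<dots> = \<alpha>"
    proof -
      \<comment> \<open>\<open>0 powr 0\<close> is 0, so positivity of \<open>lg x\<close> has to be
        used.\<close>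
      have "lg x powr 0 = 1" for x
        using order_less_le_trans[OF zero_less_one, of "lg x"] by (simp add: lg_def)
      thus ?thesis by (simp add: \<alpha>_def)
    qed
    finally show ?thesis using sum_level_error_le[OF \<epsilon> \<zeta> K(1), of T] by simp
  qed
  let ?M = "mechanism \<zeta> n T K (level_budget \<epsilon> \<zeta> K)"
  have "event_DP \<epsilon> \<delta> n T ?M"
    using \<delta> level_budget_pos[OF \<epsilon> \<zeta> K(1)] sum_level_budget_le[OF \<epsilon> \<zeta> K(1)]
    by (intro event_DP_mechanism K(2)) auto
  moreover have "\<exists>A\<in>sets (out_space n T).
       A \<subseteq> {E \<in> space (out_space n T). \<forall>L. mon_sym_norm n L \<longrightarrow>
              L (freq s t) / (1 + \<zeta>) - \<alpha> * L e1 \<le> L (out_vec n E t) \<and>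
              L (out_vec n E t) \<le> (1 + \<zeta>) * L (freq s t) + \<alpha> * L e1}
       \<and> measure (?M s) A \<ge> 2/3" if "valid_stream n T s" "t \<in> {1..T}" for s t
    by (rule mechanism_accuracy[OF \<zeta>(1) n that level_budget_pos[OF \<epsilon> \<zeta> K(1)]
          level_radius_pos[OF \<epsilon> \<zeta> K(1)] sum_failure_le[OF \<epsilon> \<zeta> K(1)] error])
       (intro bexI conjI)
  ultimately show "let \<alpha> = 509607936 * (?P * lg (1/\<delta>) / (\<epsilon>^2 * \<zeta>^5))
                  * lg (lg (real n * real T) + lg (1/\<delta>) + 1/\<epsilon> + 1/\<zeta>) powr 0
        in \<exists>M. continual_mechanism n T M \<and> event_DP \<epsilon> \<delta> n T M \<and>
           (\<forall>s t. valid_stream n T s \<longrightarrow> t \<in> {1..T} \<longrightarrow>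
              (\<exists>A\<in>sets (out_space n T).
                 A \<subseteq> {E \<in> space (out_space n T). \<forall>L. mon_sym_norm n L \<longrightarrow>
                        L (freq s t) / (1 + \<zeta>) - \<alpha> * L e1 \<le> L (out_vec n E t) \<and>
                        L (out_vec n E t) \<le> (1 + \<zeta>) * L (freq s t) + \<alpha> * L e1}
                 \<and> measure (M s) A \<ge> 2/3))"
    unfolding Let_def \<alpha>_def[symmetric]
    by (intro exI[of _ ?M] conjI continual_mechanism_mechanism) simp_all
qed auto

end
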